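(* Let $k$ be a fixed positive integer and $\sigma^2>0$. Let $\{X_n\in\mathbb{R}^{d_n},\,n\ge1\}$ be continuous random vectors satisfying the following conditions, where $\widetilde X_n$ denotes an independent copy of $X_n$: (1) $\|X_n\|^2\to\sigma^2$ in probability as $n\to\infty$; (2) $X_n'\widetilde X_n\to0$ in probability as $n\to\infty$; (3) there exists a positive integer $n_0$ such that $\mathbb{E}[(\det A_{n_0,k})^{-1/2}]<\infty$; (4) for each $n$, $\int_{-\infty}^\infty|\varphi_{X_n}(t\theta)|\,dt<\infty$ for almost all $\theta\in\mathcal{S}^{d_n-1}$. Let $\{\Xi_n\in\mathbb{R}^{d_n},\,n\ge1\}$ be random vectors, independent of $\{X_n,\,n\ge1\}$, that are spherically symmetric with $\mathbb{E}\exp(\mathrm{i}u'\Xi_n)=\psi(\|u\|^2)$ for all $u\in\mathbb{R}^{d_n}$ and all $n\ge1$, where $\psi:[0,\infty)\to\mathbb{R}$ does not depend on $n$. Let $G$ be the distribution function on $[0,\infty)$ with $\psi(t^2)=\int_0^\infty\exp(-t^2v^2/2)\,dG(v)$, $t\in\mathbb{R}$, suppose that $\int_0^\infty v^{-d_n}\,dG(v)<\infty$ for all $n$, and let $V$ be a random variable with distribution function $G$. Let $Y_n=\Xi_n'X_n$, $n\ge1$. Then, for all $j=1,\ldots,k$, $$\lim_{n\to\infty}\sup_{y\in\mathbb{R}}\Big|\mathbb{E}_{\Xi_n}\Big(\big[F_{Y_n|\Xi_n}(y)\big]^j\Big)-\mathbb{E}_V\Big(\big[F_{\mathcal{N}_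1(0,\sigma^2V^2)}(y)\big]^j\Big)\Big|=0.$$
   Context: Conventions: vectors are column vectors, $'$ denotes transpose, $\|\cdot\|$ is the Euclidean norm. The dimensions $d_1,d_2,\ldots$ form a monotonically increasing sequence of positive integers with $d_n\to\infty$. All random vectors $X_n$, $\Xi_n$ are continuous with continuous density functions, each density being supported on an open subset of $\mathbb{R}^{d_n}$. $\mathcal{S}^{d-1}$ is the unit sphere in $\mathbb{R}^d$. $\varphi_{X_n}(u)=\mathbb{E}\exp(\mathrm{i}u'X_n)$ is the characteristic function of $X_n$. $A_{n,k}=\big(\widetilde X_{n,j}'\widetilde X_{n,r}\big)_{j,r=1}^k$ is the $k\times k$ Gram matrix of mutually independent copies $\widetilde X_{n,1},\ldots,\widetilde X_{n,k}$ of $X_n$. $F_{Y_n|\Xi_n}(y)=\mathbb{P}(Y_n\le y\mid\Xi_n)$ is the conditional cumulative distribution function of $Y_n$ given $\Xi_n$. $F_{\mathcal{N}_1(0,\sigma^2V^2)}$ is, for given $V$, the cumulative distribution function of the one-dimensional normal distribution with mean $0$ and variance $\sigma^2V^2$. $\mathbb{E}_{\Xi_n}$ and $\mathbb{E}_V$ denote expectation with respect to the distributions of $\Xi_n$ and $V$. The existence of $G$ is guaranteed by Schoenberg's theorem. *)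

theory Defs
  imports "HOL-Probability.Probability" "Jordan_Normal_Form.Determinant"
begin

text \<open>
  The dimension varies along a sequence, so a vector of d-dimensional Euclidean space is an
  extensional function on \<open>{..<d}\<close>. \<open>Rn d\<close> carries Lebesgue measure on the Borel sets, and
  \<open>Rn_top d\<close> is the Euclidean topology on the same carrier.
\<close>

definition Rn :: "nat \<Rightarrow> (nat \<Rightarrow> real) measure" where
  "Rn d = Pi\<^sub>M {..<d} (\<lambda>_. lborel)"

definition Rn_top :: "nat \<Rightarrow> (nat \<Rightarrow> real) topology" where
  "Rn_top d = product_topology (\<lambda>_. euclideanreal) {..<d}"

definition vdot :: "nat \<Rightarrow> (nat \<Rightarrow> real) \<Rightarrow> (nat \<Rightarrow> real) \<Rightarrow> real" where
  "vdot d x y = (\<Sum>i<d. x i * y i)"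

definition vnorm :: "nat \<Rightarrow> (nat \<Rightarrow> real) \<Rightarrow> real" where
  "vnorm d x = L2_set x {..<d}"

definition vscale :: "nat \<Rightarrow> real \<Rightarrow> (nat \<Rightarrow> real) \<Rightarrow> (nat \<Rightarrow> real)" where
  "vscale d t x = (\<lambda>i\<in>{..<d}. t * x i)"

definition mat_app :: "nat \<Rightarrow> real mat \<Rightarrow> (nat \<Rightarrow> real) \<Rightarrow> (nat \<Rightarrow> real)" where
  "mat_app d Q x = (\<lambda>i\<in>{..<d}. \<Sum>j<d. Q $$ (i, j) * x j)"

text \<open>
  The density is continuous on an open set and vanishes outside it; it may jump at the boundary,
  as for the uniform distribution on a ball.
\<close>

definition has_continuous_density ::
    "'a measure \<Rightarrow> nat \<Rightarrow> ('a \<Rightarrow> nat \<Rightarrow> real) \<Rightarrow> bool" where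
  "has_continuous_density M d X \<longleftrightarrow>
     (\<exists>U f. openin (Rn_top d) U \<and>
        continuous_map (subtopology (Rn_top d) U) euclideanreal f \<and>
        (\<forall>x\<in>U. 0 \<le> f x) \<and> (\<forall>x. x \<notin> U \<longrightarrow> f x = 0) \<and>
        distributed M (Rn d) X (\<lambda>x. ennreal (f x)))"

definition char_fun ::
    "'a measure \<Rightarrow> nat \<Rightarrow> ('a \<Rightarrow> nat \<Rightarrow> real) \<Rightarrow> (nat \<Rightarrow> real) \<Rightarrow> complex" where
  "char_fun M d X u = (CLINT \<omega>|M. iexp (vdot d u (X \<omega>)))"

definition spherically_symmetric ::
    "'a measure \<Rightarrow> nat \<Rightarrow> ('a \<Rightarrow> nat \<Rightarrow> real) \<Rightarrow> bool" where
  "spherically_symmetric M d X \<longleftrightarrow>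
     (\<forall>Q \<in> carrier_mat d d. transpose_mat Q * Q = 1\<^sub>m d \<longrightarrow>
        distr M (Rn d) (\<lambda>\<omega>. mat_app d Q (X \<omega>)) = distr M (Rn d) X)"

definition tendsto_in_prob :: "'a measure \<Rightarrow> (nat \<Rightarrow> 'a \<Rightarrow> real) \<Rightarrow> real \<Rightarrow> bool" where
  "tendsto_in_prob M Z c \<longleftrightarrow>
     (\<forall>\<epsilon>>0. (\<lambda>n. measure M {\<omega> \<in> space M. \<epsilon> < \<bar>Z n \<omega> - c\<bar>}) \<longlonglongrightarrow> 0)"

text \<open>
  \<open>M\<close> itself need not carry independent copies of a random vector, so they are realised on the
  k-fold power of \<open>M\<close>.
\<close>

definition copy_space :: "'a measure \<Rightarrow> nat \<Rightarrow> (nat \<Rightarrow> 'a) measure" where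
  "copy_space M k = Pi\<^sub>M {..<k} (\<lambda>_. M)"

definition copy :: "('a \<Rightarrow> 'b) \<Rightarrow> nat \<Rightarrow> (nat \<Rightarrow> 'a) \<Rightarrow> 'b" where
  "copy X j w = X (w j)"

lemma copies_iid:
  assumes M: "prob_space M" and X: "X \<in> M \<rightarrow>\<^sub>M N" and k: "0 < k"
  shows "prob_space.indep_vars (copy_space M k) (\<lambda>_. N) (copy X) {..<k}"
    and "j < k \<Longrightarrow> distr (copy_space M k) N (copy X j) = distr M N X"
proof -
  interpret P: product_prob_space "\<lambda>_. M" "{..<k}"
    using M by (simp add: product_prob_space_def product_prob_space_axioms_def
        product_sigma_finite_def prob_space_imp_sigma_finite)
  have d: "distr (copy_space M k) N (copy X j) = distr M N X" if "j < k" for j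
  proof -
    have "distr (copy_space M k) N (copy X j) =
          distr (distr (copy_space M k) M (\<lambda>w. w j)) N X"
      using that X by (subst distr_distr) (auto simp: copy_space_def copy_def[abs_def] comp_def)
    also have "distr (copy_space M k) M (\<lambda>w. w j) = M"
      using that unfolding copy_space_def
      by (intro distr_PiM_component) (auto simp: M)
    finally show ?thesis .
  qed
  show "j < k \<Longrightarrow> distr (copy_space M k) N (copy X j) = distr M N X" by (rule d)
  have "P.indep_vars (\<lambda>_. M) (\<lambda>i w. w i) {..<k}"
  proof (subst P.indep_vars_iff_distr_eq_PiM')
    show "{..<k} \<noteq> {}" using k by auto
    have "distr (Pi\<^sub>M {..<k} (\<lambda>_. M)) (Pi\<^sub>M {..<k} (\<lambda>_. M)) (\<lambda>w. \<lambda>i\<in>{..<k}. w i)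
          = distr (Pi\<^sub>M {..<k} (\<lambda>_. M)) (Pi\<^sub>M {..<k} (\<lambda>_. M)) (\<lambda>w. w)"
      by (rule distr_cong) (auto simp: space_PiM)
    also have "\<dots> = (\<Pi>\<^sub>M i\<in>{..<k}. distr (Pi\<^sub>M {..<k} (\<lambda>_. M)) M (\<lambda>w. w i))"
    proof -
      have "distr (Pi\<^sub>M {..<k} (\<lambda>_. M)) M (\<lambda>w. w i) = M" if "i < k" for i
        using that M by (intro distr_PiM_component) auto
      then have "(\<Pi>\<^sub>M i\<in>{..<k}. distr (Pi\<^sub>M {..<k} (\<lambda>_. M)) M (\<lambda>w. w i)) = Pi\<^sub>M {..<k} (\<lambda>_. M)"
        by (intro PiM_cong) auto
      then show ?thesis by simp
    qed
    finally show "distr (Pi\<^sub>M {..<k} (\<lambda>_. M)) (Pi\<^sub>M {..<k} (\<lambda>_. M)) (\<lambda>w. \<lambda>i\<in>{..<k}. w i)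
          = (\<Pi>\<^sub>M i\<in>{..<k}. distr (Pi\<^sub>M {..<k} (\<lambda>_. M)) M (\<lambda>w. w i))" .
  qed simp
  then show "prob_space.indep_vars (copy_space M k) (\<lambda>_. N) (copy X) {..<k}"
    unfolding copy_space_def copy_def[abs_def]
    by (rule P.indep_vars_compose2) (use X in auto)
qed

definition gram :: "nat \<Rightarrow> nat \<Rightarrow> ('a \<Rightarrow> nat \<Rightarrow> real) \<Rightarrow> (nat \<Rightarrow> 'a) \<Rightarrow> real mat" where
  "gram d k X w = Matrix.mat k k (\<lambda>(j, r). vdot d (copy X j w) (copy X r w))"

text \<open>
  Surface measure on the unit sphere, as d times the cone measure: a set A of unit vectors gets
  d times the Lebesgue measure of the points of the punctured unit ball with direction in A.
  For \<open>d = 1\<close> this is counting measure on two points.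
\<close>

definition usphere :: "nat \<Rightarrow> (nat \<Rightarrow> real) set" where
  "usphere d = {x \<in> space (Rn d). vnorm d x = 1}"

definition punctured_ball :: "nat \<Rightarrow> (nat \<Rightarrow> real) set" where
  "punctured_ball d = {x \<in> space (Rn d). 0 < vnorm d x \<and> vnorm d x \<le> 1}"

definition surface_measure :: "nat \<Rightarrow> (nat \<Rightarrow> real) measure" where
  "surface_measure d =
     scale_measure (of_nat d)
       (distr (restrict_space (Rn d) (punctured_ball d)) (restrict_space (Rn d) (usphere d))
          (\<lambda>x. vscale d (1 / vnorm d x) x))"

lemma direction_measurable:
  "(\<lambda>x. vscale d (1 / vnorm d x) x)
     \<in> restrict_space (Rn d) (punctured_ball d) \<rightarrow>\<^sub>M restrict_space (Rn d) (usphere d)"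
proof (rule measurable_restrict_space3)
  show "(\<lambda>x. vscale d (1 / vnorm d x) x) \<in> Rn d \<rightarrow>\<^sub>M Rn d"
    unfolding Rn_def vscale_def vnorm_def L2_set_def by measurable
  show "(\<lambda>x. vscale d (1 / vnorm d x) x) \<in> punctured_ball d \<rightarrow> usphere d"
  proof
    fix x assume x: "x \<in> punctured_ball d"
    then have pos: "0 < vnorm d x" by (simp add: punctured_ball_def)
    have "vnorm d (vscale d (1 / vnorm d x) x) = L2_set (\<lambda>i. (1 / vnorm d x) * x i) {..<d}"
      unfolding vnorm_def vscale_def by (intro L2_set_cong) auto
    also have "\<dots> = (1 / vnorm d x) * vnorm d x"
      using pos by (subst L2_set_right_distrib[symmetric]) (auto simp: vnorm_def)
    also have "\<dots> = 1" using pos by simp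
    finally show "vscale d (1 / vnorm d x) x \<in> usphere d"
      by (simp add: usphere_def Rn_def space_PiM vscale_def)
  qed
qed

definition distribution_function_nonneg :: "(real \<Rightarrow> real) \<Rightarrow> bool" where
  "distribution_function_nonneg G \<longleftrightarrow>
     mono G \<and> (\<forall>v. continuous (at_right v) G) \<and> (\<forall>v<0. G v = 0) \<and> (G \<longlongrightarrow> 1) at_top"

text \<open>
  A version of \<open>\<omega> \<mapsto> P(Y \<le> y | \<Xi>)\<close>, i.e. of the conditional probability given the
  \<open>\<sigma>\<close>-algebra generated by \<open>\<Xi>\<close>. It is a \<open>\<Xi>\<close>-measurable function on the underlying space, so the
  expectation with respect to the distribution of \<open>\<Xi>\<close> is an integral over \<open>M\<close>.
\<close>

definition cond_cdf ::
    "'a measure \<Rightarrow> 'b measure \<Rightarrow> ('a \<Rightarrow> 'b) \<Rightarrow> ('a \<Rightarrow> real) \<Rightarrow> real \<Rightarrow> 'a \<Rightarrow> real" where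
  "cond_cdf M N \<Xi> Y y =
     real_cond_exp M (vimage_algebra (space M) \<Xi> N) (indicator {\<omega> \<in> space M. Y \<omega> \<le> y})"

lemma subalgebra_vimage_algebra:
  assumes "\<Xi> \<in> M \<rightarrow>\<^sub>M N"
  shows "subalgebra M (vimage_algebra (space M) \<Xi> N)"
  using assms by (simp add: subalgebra_def sets_vimage_algebra2[OF measurable_space[THEN funcsetI]]
      measurable_iff_sets sets_vimage_algebra_space)

text \<open>The second parameter is the variance; \<open>normal_density\<close> takes the standard deviation.\<close>

definition normal_law :: "real \<Rightarrow> real \<Rightarrow> real measure" where
  "normal_law m v =
     (if v = 0 then return borel m else density lborel (\<lambda>x. ennreal (normal_density m (sqrt v) x)))"

end

theory Submission
  imports Defs
begin

text \<open>
  Given \<open>\<Xi>\<close>, let \<open>L\<close> be the random law of \<open>\<Xi>'X\<close>, with characteristic function \<open>\<phi>\<close>. Fubini turns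
  \<open>E (\<phi> t\<^sub>1 \<cdots> \<phi> t\<^sub>j)\<close> into \<open>E (\<psi> (t'At))\<close>, where \<open>A\<close> is the Gram matrix of \<open>j\<close> independent copies
  of \<open>X\<close>. Conditions (1) and (2) say that \<open>A\<close> tends to \<open>\<sigma>\<^sup>2\<close> times the identity in probability,
  so these mixed moments tend to those of the random law \<open>N(0, \<sigma>\<^sup>2V\<^sup>2)\<close>. Integrating against
  Fourier transforms gives convergence of \<open>E ((\<integral>g dL)\<^sup>j)\<close> for Gaussian smoothings \<open>g\<close> of the indicator
  of a half-line. The smoothing error is controlled by the mean law \<open>E L\<close> alone, to which Levy's
  continuity theorem on the line applies. As \<open>V\<close> has no atom at 0, the limit is a continuous
  distribution function, and Polya's argument makes the convergence uniform.
\<close>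

subsection \<open>Monotone functions converging to a continuous limit\<close>

text \<open>Given \<open>\<Xi> n\<close>, the law of the inner product stays random in the limit: it
  is normal with the random variance \<open>\<sigma>\<^sup>2 * V\<^sup>2\<close>, and
  \<open>\<Xi> n\<close> and \<open>V\<close> live on unrelated spaces. Only averaged quantities can
  be compared, here means of j-th powers of integrals. These are not linear in the law, but a j-th
  power of an integral is an integral over j independent samples, which brings Fubini into play. A
  half-line indicator is not the Fourier transform of a finite measure, so it is truncated and
  smoothed first; since \<open>x ^ j\<close> is Lipschitz on the unit interval, the cost of this is
  bounded by an expression linear in the law. That is why the nonrandom mean law controls the error
  for every j. The integrability of \<open>v\<close> to the power \<open>- d n\<close> is what
  removes an atom of \<open>V\<close> at 0: such an atom would make that integral infinite. It would
  also give the limit function a jump at 0, where Polya's argument breaks down.\<close>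

lemma Polya_uniform_limit:
  fixes F :: "nat \<Rightarrow> real \<Rightarrow> real" and H :: "real \<Rightarrow> real"
  assumes mono: "\<And>n. mono (F n)"
    and F0: "\<And>n y. 0 \<le> F n y" and F1: "\<And>n y. F n y \<le> 1"
    and lim: "\<And>y. (\<lambda>n. F n y) \<longlonglongrightarrow> H y"
    and cont: "\<And>y. isCont H y"
    and bot: "(H \<longlongrightarrow> 0) at_bot" and top: "(H \<longlongrightarrow> 1) at_top"
  shows "uniform_limit UNIV F H sequentially"
proof (rule uniform_limitI)
  fix e :: real assume e: "e > 0"
  have H0: "0 \<le> H y" and H1: "H y \<le> 1" for y
    using LIMSEQ_le_const[OF lim, of 0 y] LIMSEQ_le_const2[OF lim, of y 1] F0 F1 by auto
  have near: "\<forall>\<^sub>F n in sequentially. \<bar>F n y - H y\<bar> < e / 4" for y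
    using tendstoD[OF lim[of y], of "e/4"] e by (simp add: dist_real_def)
  obtain a where a: "\<And>y. y \<le> a \<Longrightarrow> H y < e / 4"
    using order_tendstoD(2)[OF bot, of "e/4"] e unfolding eventually_at_bot_linorder by auto
  obtain b where b: "\<And>y. y \<ge> b \<Longrightarrow> H y > 1 - e / 4"
    using order_tendstoD(1)[OF top, of "1 - e/4"] e unfolding eventually_at_top_linorder by auto
  \<comment> \<open>The neighbourhood is closed because \<open>H\<close> is evaluated at its
    endpoints \<open>x - r x\<close> and \<open>x + r x\<close> below.\<close>
  have "\<exists>r>0. \<forall>z. \<bar>z - x\<bar> \<le> r \<longrightarrow> \<bar>H z - H x\<bar> < e / 4" for x
  proof -
    obtain s where "s > 0" "\<And>z. \<bar>z - x\<bar> < s \<Longrightarrow> \<bar>H z - H x\<bar> < e / 4"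
      using cont[of x, unfolded continuous_at_eps_delta, rule_format, of "e/4"] e
      unfolding dist_real_def by auto
    then show ?thesis by (intro exI[of _ "s/2"]) auto
  qed
  then obtain r where r: "\<And>x. r x > 0" "\<And>x z. \<bar>z - x\<bar> \<le> r x \<Longrightarrow> \<bar>H z - H x\<bar> < e / 4"
    by metis
  obtain D where D: "finite D" "{a..b} \<subseteq> (\<Union>x\<in>D. ball x (r x))"
  proof (rule compactE_image[of "{a..b}" UNIV "\<lambda>x. ball x (r x)"])
    show "{a..b} \<subseteq> (\<Union>x\<in>UNIV. ball x (r x))"
    proof
      fix x
      show "x \<in> (\<Union>x\<in>UNIV. ball x (r x))"
        using r(1)[of x] by (intro UN_I[of x]) auto
    qed
  qed (use that in auto)
  \<comment> \<open>Pointwise convergence is needed at finitely many points only: the ends of the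
    covering intervals here, and \<open>a\<close> and \<open>b\<close> for the two tails.
    Monotonicity of \<open>F n\<close> carries the estimate to all points between.\<close>
  have "\<forall>\<^sub>F n in sequentially. \<forall>x\<in>D. \<bar>F n (x - r x) - H (x - r x)\<bar> < e / 4
      \<and> \<bar>F n (x + r x) - H (x + r x)\<bar> < e / 4"
    using D(1) near by (auto simp: eventually_ball_finite_distrib eventually_conj_iff)
  then have "\<forall>\<^sub>F n in sequentially. \<forall>y. \<bar>F n y - H y\<bar> < e"
    using near[of a] near[of b]
  proof eventually_elim
    case (elim n)
    note mn = monoD[OF mono[of n]]
    show ?case
    proof
      fix y
      consider "y \<le> a" | "y \<ge> b" | "y \<in> {a..b}" by fastforce
      then show "\<bar>F n y - H y\<bar> < e"
      proof cases
        case 1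
        then show ?thesis
          using mn[OF 1] a[OF 1] a[of a] F0[of n y] H0[of y] elim by linarith
      next
        case 2
        then show ?thesis
          using mn[OF 2] b[OF 2] b[of b] F1[of n y] H1[of y] elim by linarith
      next
        case 3
        then have "y \<in> (\<Union>x\<in>D. ball x (r x))" using D(2) by blast
        then obtain x where x: "x \<in> D" "\<bar>y - x\<bar> < r x"
          by (auto simp: dist_real_def abs_minus_commute)
        have "F n (x - r x) \<le> F n y" "F n y \<le> F n (x + r x)"
          using x(2) by (auto intro!: mn)
        moreover have "\<bar>F n (x - r x) - H (x - r x)\<bar> < e / 4" "\<bar>F n (x + r x) - H (x + r x)\<bar> < e / 4"
          using elim(1) x(1) by auto
        moreover have "\<bar>H (x - r x) - H x\<bar> < e / 4" "\<bar>H (x + r x) - H x\<bar> < e / 4"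
            "\<bar>H y - H x\<bar> < e / 4"
          using r(1)[of x] x(2) by (simp_all add: r(2) del: less_divide_eq_numeral1)
        ultimately show ?thesis by linarith
      qed
    qed
  qed
  then show "\<forall>\<^sub>F n in sequentially. \<forall>x\<in>UNIV. dist (F n x) (H x) < e"
    by (simp add: dist_real_def)
qed

lemma uniform_limit_imp_SUP_tendsto_0:
  fixes F :: "nat \<Rightarrow> real \<Rightarrow> real"
  assumes "uniform_limit UNIV F H sequentially"
  shows "(\<lambda>n. SUP y. \<bar>F n y - H y\<bar>) \<longlonglongrightarrow> 0"
proof (rule tendstoI)
  fix e :: real assume e: "e > 0"
  have "\<forall>\<^sub>F n in sequentially. \<forall>y. \<bar>F n y - H y\<bar> < e / 2"
    using uniform_limitD[OF assms, of "e/2"] e by (simp add: dist_real_def)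
  then show "\<forall>\<^sub>F n in sequentially. dist (SUP y. \<bar>F n y - H y\<bar>) 0 < e"
  proof eventually_elim
    case (elim n)
    have "(SUP y. \<bar>F n y - H y\<bar>) \<le> e / 2"
      using elim by (intro cSUP_least) (auto intro: less_imp_le)
    \<comment> \<open>Any member of the family shows that the supremum is nonnegative, which the
      distance to 0 also requires.\<close>
    moreover have "\<bar>F n 0 - H 0\<bar> \<le> (SUP y. \<bar>F n y - H y\<bar>)"
      using elim by (intro cSUP_upper bdd_aboveI[of _ "e/2"]) (auto intro: less_imp_le)
    ultimately show ?case using e by (simp add: dist_real_def)
  qed
qed

subsection \<open>Random laws on the line\<close>

text \<open>A random law is encoded by a jointly measurable map: the first argument selects the law,
  the second is the sample. This covers both sides of the comparison, with \<open>P = Q = M\<close>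
  before the limit, and with \<open>N\<close> and a standard normal sample in the limit. Joint
  measurability is what Fubini needs.\<close>

locale random_law = P: prob_space P + Q: prob_space Q
  for P :: "'a measure" and Q :: "'b measure" +
  fixes f :: "'a \<Rightarrow> 'b \<Rightarrow> real"
  assumes f [measurable]: "case_prod f \<in> borel_measurable (P \<Otimes>\<^sub>M Q)"
begin

sublocale PQ: pair_prob_space P Q ..

definition law :: "'a \<Rightarrow> real measure" where
  "law \<omega> = distr Q borel (f \<omega>)"

definition mean_law :: "real measure" where
  "mean_law = distr (P \<Otimes>\<^sub>M Q) borel (case_prod f)"

lemma f_section [measurable (raw)]:
  "\<omega> \<in> space P \<Longrightarrow> f \<omega> \<in> borel_measurable Q"
  using measurable_Pair2[OF f] by simp

lemma real_distribution_law: "\<omega> \<in> space P \<Longrightarrow> real_distribution (law \<omega>)"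
  unfolding law_def by (rule Q.real_distribution_distr) (rule f_section)

lemma real_distribution_mean_law: "real_distribution mean_law"
  unfolding mean_law_def by (rule PQ.real_distribution_distr) simp

lemma integral_law:
  fixes g :: "real \<Rightarrow> 'c::{banach, second_countable_topology}"
  assumes [measurable]: "g \<in> borel_measurable borel" and "\<omega> \<in> space P"
  shows "(\<integral>y. g y \<partial>law \<omega>) = (\<integral>x. g (f \<omega> x) \<partial>Q)"
  unfolding law_def using assms(2) by (subst integral_distr) auto

lemma integrable_law:
  fixes g :: "real \<Rightarrow> 'c::{banach, second_countable_topology}"
  assumes "g \<in> borel_measurable borel" "\<And>y. norm (g y) \<le> B" "\<omega> \<in> space P"
  shows "integrable (law \<omega>) g"
proof -
  interpret L: real_distribution "law \<omega>" using assms(3) by (rule real_distribution_law)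
  show ?thesis using assms(1,2) by (intro L.integrable_const_bound[where B=B]) auto
qed

lemma borel_measurable_integral_law [measurable]:
  fixes g :: "real \<Rightarrow> 'c::{banach, second_countable_topology}"
  assumes [measurable]: "g \<in> borel_measurable borel"
  shows "(\<lambda>\<omega>. \<integral>y. g y \<partial>law \<omega>) \<in> borel_measurable P"
proof -
  have "(\<lambda>\<omega>. \<integral>x. g (f \<omega> x) \<partial>Q) \<in> borel_measurable P"
    by measurable
  then show ?thesis
    by (subst measurable_cong[OF integral_law]) auto
qed

text \<open>Measurability in \<open>\<omega>\<close> and \<open>t\<close> jointly, because the
  frequency is later integrated together with \<open>\<omega>\<close>.\<close>

lemma borel_measurable_char_law:
  "(\<lambda>(\<omega>, t). char (law \<omega>) t) \<in> borel_measurable (P \<Otimes>\<^sub>M borel)"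
proof -
  have "(\<lambda>z. \<integral>x. iexp (snd z * f (fst z) x) \<partial>Q) \<in> borel_measurable (P \<Otimes>\<^sub>M borel)"
    by measurable
  moreover have "(case z of (\<omega>, t) \<Rightarrow> char (law \<omega>) t) = (\<integral>x. iexp (snd z * f (fst z) x) \<partial>Q)"
    if "z \<in> space (P \<Otimes>\<^sub>M borel)" for z
    using that by (auto simp: char_def integral_law space_pair_measure)
  ultimately show ?thesis
    by (subst measurable_cong) auto
qed

lemma norm_integral_law_le:
  fixes g :: "real \<Rightarrow> 'c::{banach, second_countable_topology}"
  assumes [measurable]: "g \<in> borel_measurable borel" and B: "\<And>y. norm (g y) \<le> B"
    and \<omega>: "\<omega> \<in> space P"
  shows "norm (\<integral>y. g y \<partial>law \<omega>) \<le> B"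
proof -
  interpret L: real_distribution "law \<omega>" using \<omega> by (rule real_distribution_law)
  have "norm (\<integral>y. g y \<partial>law \<omega>) \<le> (\<integral>y. norm (g y) \<partial>law \<omega>)"
    by (rule integral_norm_bound)
  also have "\<dots> \<le> B"
    using B by (intro L.integral_le_const integrable_law[where B=B]) (auto simp: \<omega>)
  finally show ?thesis .
qed

lemma integral_mean_law:
  fixes g :: "real \<Rightarrow> 'c::{banach, second_countable_topology}"
  assumes [measurable]: "g \<in> borel_measurable borel" and B: "\<And>y. norm (g y) \<le> B"
  shows "(\<integral>\<omega>. \<integral>y. g y \<partial>law \<omega> \<partial>P) = (\<integral>y. g y \<partial>mean_law)"
proof -
  have "integrable (P \<Otimes>\<^sub>M Q) (\<lambda>(\<omega>, x). g (f \<omega> x))"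
    using B by (intro PQ.integrable_const_bound[where B=B]) (auto simp: split_beta)
  then have "(\<integral>\<omega>. \<integral>x. g (f \<omega> x) \<partial>Q \<partial>P) = (\<integral>z. g (case_prod f z) \<partial>(P \<Otimes>\<^sub>M Q))"
    by (subst PQ.integral_fst) (auto simp: split_beta')
  then show ?thesis
    unfolding mean_law_def by (subst integral_distr) (auto simp: integral_law cong: Bochner_Integration.integral_cong)
qed

lemma char_mean_law: "char mean_law t = (\<integral>\<omega>. char (law \<omega>) t \<partial>P)"
  unfolding char_def by (rule integral_mean_law[symmetric, where B=1]) auto

text \<open>On \<open>[-1, 1]\<close> the map \<open>x ^ j\<close> is Lipschitz with constant
  \<open>j\<close>, and both inner integrals lie there. What remains is linear in the random law, so
  averaging over \<open>P\<close> leaves only the mean law.\<close>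

lemma integral_law_power_diff_le:
  fixes g h :: "real \<Rightarrow> real"
  assumes [measurable]: "g \<in> borel_measurable borel" "h \<in> borel_measurable borel"
    and g: "\<And>y. \<bar>g y\<bar> \<le> 1" and h: "\<And>y. \<bar>h y\<bar> \<le> 1"
  shows "\<bar>(\<integral>\<omega>. (\<integral>y. g y \<partial>law \<omega>) ^ j \<partial>P) - (\<integral>\<omega>. (\<integral>y. h y \<partial>law \<omega>) ^ j \<partial>P)\<bar>
    \<le> j * (\<integral>y. \<bar>g y - h y\<bar> \<partial>mean_law)"
proof -
  have ge: "norm (\<integral>y. g y \<partial>law \<omega>) \<le> 1" "norm (\<integral>y. h y \<partial>law \<omega>) \<le> 1" if "\<omega> \<in> space P" for \<omega>
    using norm_integral_law_le[OF assms(1) _ that, of 1] norm_integral_law_le[OF assms(2) _ that, of 1] g h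
    by simp_all
  have int: "integrable P (\<lambda>\<omega>. (\<integral>y. u y \<partial>law \<omega>) ^ j)"
    if [measurable]: "u \<in> borel_measurable borel" and u: "\<And>y. \<bar>u y\<bar> \<le> 1" for u :: "real \<Rightarrow> real"
  proof (intro P.integrable_const_bound[where B=1] AE_I2)
    fix \<omega> assume "\<omega> \<in> space P"
    then show "norm ((\<integral>y. u y \<partial>law \<omega>) ^ j) \<le> 1"
      using u norm_integral_law_le[of u 1 \<omega>] by (auto simp: power_abs intro!: power_le_one)
  qed auto
  have gh: "\<bar>\<bar>g y - h y\<bar>\<bar> \<le> 2" for y using g[of y] h[of y] by simp
  have "\<bar>(\<integral>\<omega>. (\<integral>y. g y \<partial>law \<omega>) ^ j \<partial>P) - (\<integral>\<omega>. (\<integral>y. h y \<partial>law \<omega>) ^ j \<partial>P)\<bar>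
      = \<bar>\<integral>\<omega>. (\<integral>y. g y \<partial>law \<omega>) ^ j - (\<integral>y. h y \<partial>law \<omega>) ^ j \<partial>P\<bar>"
    by (subst Bochner_Integration.integral_diff) (auto intro!: int g h)
  also have "\<dots> \<le> (\<integral>\<omega>. \<bar>(\<integral>y. g y \<partial>law \<omega>) ^ j - (\<integral>y. h y \<partial>law \<omega>) ^ j\<bar> \<partial>P)"
    by (rule integral_abs_bound)
  also have "\<dots> \<le> (\<integral>\<omega>. j * (\<integral>y. \<bar>g y - h y\<bar> \<partial>law \<omega>) \<partial>P)"
  proof (intro integral_mono)
    show "integrable P (\<lambda>\<omega>. \<bar>(\<integral>y. g y \<partial>law \<omega>) ^ j - (\<integral>y. h y \<partial>law \<omega>) ^ j\<bar>)"
      by (intro integrable_abs Bochner_Integration.integrable_diff int assms)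
    show "integrable P (\<lambda>\<omega>. j * (\<integral>y. \<bar>g y - h y\<bar> \<partial>law \<omega>))"
      using gh norm_integral_law_le[of "\<lambda>y. \<bar>g y - h y\<bar>" 2]
      by (intro integrable_mult_right P.integrable_const_bound[where B=2]) auto
    fix \<omega> assume \<omega>: "\<omega> \<in> space P"
    have "norm ((\<integral>y. g y \<partial>law \<omega>) ^ j - (\<integral>y. h y \<partial>law \<omega>) ^ j)
        \<le> j * norm ((\<integral>y. g y \<partial>law \<omega>) - (\<integral>y. h y \<partial>law \<omega>))"
      by (intro norm_power_diff ge \<omega>)
    also have "(\<integral>y. g y \<partial>law \<omega>) - (\<integral>y. h y \<partial>law \<omega>) = (\<integral>y. g y - h y \<partial>law \<omega>)"
      using g h \<omega> by (subst Bochner_Integration.integral_diff) (auto intro!: integrable_law[where B=1])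
    also have "norm \<dots> \<le> (\<integral>y. norm (g y - h y) \<partial>law \<omega>)"
      by (rule integral_norm_bound)
    finally show "\<bar>(\<integral>y. g y \<partial>law \<omega>) ^ j - (\<integral>y. h y \<partial>law \<omega>) ^ j\<bar>
        \<le> j * (\<integral>y. \<bar>g y - h y\<bar> \<partial>law \<omega>)"
      by (simp add: mult_left_mono)
  qed
  also have "\<dots> = j * (\<integral>y. \<bar>g y - h y\<bar> \<partial>mean_law)"
    using gh by (subst integral_mult_right_zero, subst integral_mean_law[where B=2]) auto
  finally show ?thesis .
qed

lemma cdf_law_eq: "\<omega> \<in> space P \<Longrightarrow> cdf (law \<omega>) y = (\<integral>u. indicator {..y} u \<partial>law \<omega>)"
  using real_distribution_law[of \<omega>]
  by (simp add: cdf_def real_distribution.space_eq_univ)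

lemma borel_measurable_char_law_component:
  assumes \<tau>: "sets \<tau> = sets borel" and i: "i \<in> I"
  shows "(\<lambda>(t, \<omega>). char (law \<omega>) (t i)) \<in> borel_measurable (Pi\<^sub>M I (\<lambda>_. \<tau>) \<Otimes>\<^sub>M P)"
proof -
  have ti: "(\<lambda>t. t i) \<in> Pi\<^sub>M I (\<lambda>_. \<tau>) \<rightarrow>\<^sub>M borel"
    using i by (subst measurable_cong_sets[OF refl \<tau>[symmetric]])
      (rule measurable_component_singleton)
  have "(\<lambda>(t, \<omega>). (\<omega>, t i)) \<in> Pi\<^sub>M I (\<lambda>_. \<tau>) \<Otimes>\<^sub>M P \<rightarrow>\<^sub>M P \<Otimes>\<^sub>M borel"
    unfolding split_beta'
    by (intro measurable_Pair measurable_compose[OF measurable_fst ti] measurable_snd)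
  from measurable_compose[OF this borel_measurable_char_law] show ?thesis
    by (simp add: split_beta)
qed

text \<open>By Parseval the inner integral becomes an integral of \<open>h\<close> times the
  characteristic function against \<open>\<tau>\<close>. Its j-th power is an integral over the
  j-fold product of \<open>\<tau>\<close>, and exchanging the order leaves only the mixed moments of
  the characteristic function. With \<open>\<tau>\<close> a probability measure and \<open>h\<close>
  bounded, all integrands are bounded on probability spaces, which settles integrability at each
  exchange.\<close>

lemma integral_Fourier_power:
  fixes h :: "real \<Rightarrow> complex"
  assumes \<tau>: "real_distribution \<tau>" and [measurable]: "h \<in> borel_measurable borel"
    and B: "\<And>t. cmod (h t) \<le> B"
    and g [measurable]: "g \<in> borel_measurable borel"
    and g_eq: "\<And>y. complex_of_real (g y) = (CLINT t|\<tau>. h t * iexp (t * y))"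
  shows "complex_of_real (\<integral>\<omega>. (\<integral>y. g y \<partial>law \<omega>) ^ j \<partial>P) =
    (\<integral>t. (\<Prod>i<j. h (t i)) * (\<integral>\<omega>. (\<Prod>i<j. char (law \<omega>) (t i)) \<partial>P) \<partial>Pi\<^sub>M {..<j} (\<lambda>_. \<tau>))"
proof -
  interpret \<tau>: real_distribution \<tau> by fact
  interpret T: product_prob_space "\<lambda>_. \<tau>" "{..<j}"
    by (simp add: product_prob_space_def product_prob_space_axioms_def
        product_sigma_finite_def \<tau>.prob_space_axioms prob_space_imp_sigma_finite)
  interpret TP: pair_prob_space "Pi\<^sub>M {..<j} (\<lambda>_. \<tau>)" P
    by (simp add: pair_prob_space_def pair_sigma_finite_def P.prob_space_axioms T.prob_space_axioms
        prob_space_imp_sigma_finite)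
  have B0: "0 \<le> B" using B[of 0] norm_ge_zero by (rule order_trans[rotated])
  have char_le: "cmod (char (law \<omega>) t) \<le> 1" if "\<omega> \<in> space P" for \<omega> t
    using real_distribution_law[OF that] by (rule real_distribution.cmod_char_le_1)
  have K: "complex_of_real (\<integral>y. g y \<partial>law \<omega>) = (CLINT t|\<tau>. h t * char (law \<omega>) t)"
    if \<omega>: "\<omega> \<in> space P" for \<omega>
  proof -
    interpret L: real_distribution "law \<omega>" using \<omega> by (rule real_distribution_law)
    interpret TL: pair_prob_space \<tau> "law \<omega>" ..
    have "complex_of_real (\<integral>y. g y \<partial>law \<omega>) = (\<integral>y. complex_of_real (g y) \<partial>law \<omega>)"
      by simp
    also have "\<dots> = (\<integral>y. (CLINT t|\<tau>. h t * iexp (t * y)) \<partial>law \<omega>)"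
      by (simp only: g_eq)
    also have "\<dots> = (\<integral>t. (CLINT y|law \<omega>. h t * iexp (t * y)) \<partial>\<tau>)"
    proof (rule TL.Fubini_integral, rule TL.integrable_const_bound[where B=B])
      show "AE x in \<tau> \<Otimes>\<^sub>M law \<omega>. cmod (case x of (t, y) \<Rightarrow> h t * iexp (t * y)) \<le> B"
        using B by (auto simp: norm_mult)
    qed measurable
    finally show ?thesis by (simp add: char_def)
  qed
  have [measurable]: "char (law \<omega>) \<in> borel_measurable borel" if "\<omega> \<in> space P" for \<omega>
    using real_distribution_law[OF that] by (rule real_distribution.char_measurable)
  have KK: "complex_of_real ((\<integral>y. g y \<partial>law \<omega>) ^ j) =
      (\<integral>t. (\<Prod>i<j. h (t i) * char (law \<omega>) (t i)) \<partial>Pi\<^sub>M {..<j} (\<lambda>_. \<tau>))" if \<omega>: "\<omega> \<in> space P" for \<omega>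
  proof -
    \<comment> \<open>The bound is kept as \<open>B * 1\<close>, one factor for \<open>h\<close> and
      one for the characteristic function, so that monotonicity of multiplication applies factor by
      factor.\<close>
    have "integrable \<tau> (\<lambda>t. h t * char (law \<omega>) t)"
      using B char_le \<omega> B0
      by (intro \<tau>.integrable_const_bound[where B="B * 1"])
         (auto simp: norm_mult simp del: mult_1_right intro!: mult_mono AE_I2)
    then show ?thesis
      by (subst T.product_integral_prod) (auto simp: K[OF \<omega>])
  qed
  have [measurable]: "(\<lambda>(t, \<omega>). char (law \<omega>) (t i)) \<in> borel_measurable (Pi\<^sub>M {..<j} (\<lambda>_. \<tau>) \<Otimes>\<^sub>M P)"
    if "i < j" for i
    using that by (intro borel_measurable_char_law_component \<tau>.events_eq_borel) auto
  have "complex_of_real (\<integral>\<omega>. (\<integral>y. g y \<partial>law \<omega>) ^ j \<partial>P)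
      = (\<integral>\<omega>. complex_of_real ((\<integral>y. g y \<partial>law \<omega>) ^ j) \<partial>P)"
    by (rule integral_complex_of_real[symmetric])
  also have "\<dots> = (\<integral>\<omega>. (\<integral>t. (\<Prod>i<j. h (t i) * char (law \<omega>) (t i)) \<partial>Pi\<^sub>M {..<j} (\<lambda>_. \<tau>)) \<partial>P)"
    by (intro Bochner_Integration.integral_cong KK) auto
  also have "\<dots> = (\<integral>t. (\<integral>\<omega>. (\<Prod>i<j. h (t i) * char (law \<omega>) (t i)) \<partial>P) \<partial>Pi\<^sub>M {..<j} (\<lambda>_. \<tau>))"
  proof (rule TP.Fubini_integral, rule TP.integrable_const_bound[where B="(\<Prod>i<j. B * 1)"])
    show "AE x in Pi\<^sub>M {..<j} (\<lambda>_. \<tau>) \<Otimes>\<^sub>M P.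
        cmod (case x of (t, \<omega>) \<Rightarrow> \<Prod>i<j. h (t i) * char (law \<omega>) (t i)) \<le> (\<Prod>i<j. B * 1)"
      using B char_le B0
      by (auto simp: prod_norm[symmetric] norm_mult space_pair_measure simp del: mult_1_right prod_constant
          intro!: prod_mono mult_mono AE_I2)
  qed (simp add: split_beta', measurable)
  also have "\<dots> = (\<integral>t. (\<Prod>i<j. h (t i)) * (\<integral>\<omega>. (\<Prod>i<j. char (law \<omega>) (t i)) \<partial>P) \<partial>Pi\<^sub>M {..<j} (\<lambda>_. \<tau>))"
    by (simp add: prod.distrib)
  finally show ?thesis .
qed

end

subsection \<open>Gaussian smoothing of half-line indicators\<close>

text \<open>The convolution of the indicator of \<open>{-m..b}\<close> with the centred normal law
  of standard deviation \<open>1 / m\<close>. The cutoff at \<open>-m\<close> makes the interval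
  finite, so that its Fourier transform is bounded; the Gaussian supplies a finite measure on the
  frequency side. One parameter drives both approximations.\<close>

definition smooth_indicator :: "real \<Rightarrow> real \<Rightarrow> real \<Rightarrow> real" where
  "smooth_indicator m b y = (\<integral>z. indicator {-m..b} (y + z / m) \<partial>std_normal_distribution)"

lemma smooth_indicator_nonneg: "0 \<le> smooth_indicator m b y"
  unfolding smooth_indicator_def by (intro Bochner_Integration.integral_nonneg) simp

lemma smooth_indicator_le_1: "smooth_indicator m b y \<le> 1"
proof -
  interpret real_distribution std_normal_distribution by (rule real_dist_normal_dist)
  show ?thesis
    unfolding smooth_indicator_def
    by (intro integral_le_const integrable_const_bound[where B=1]) (auto simp: indicator_le_1)
qed

lemma smooth_indicator_measurable [measurable]:
  "smooth_indicator m b \<in> borel_measurable borel"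
proof -
  interpret real_distribution std_normal_distribution by (rule real_dist_normal_dist)
  show ?thesis unfolding smooth_indicator_def by measurable
qed

lemma isCont_smooth_indicator:
  assumes "m > 0"
  shows "isCont (smooth_indicator m b) y"
  unfolding continuous_at_sequentially
proof safe
  interpret real_distribution std_normal_distribution by (rule real_dist_normal_dist)
  fix s assume s: "s \<longlonglongrightarrow> y"
  \<comment> \<open>These are the two values of \<open>z\<close> for which \<open>y + z / m\<close>
    hits an endpoint of the interval, the only discontinuities of the indicator.\<close>
  have null: "AE z in std_normal_distribution. z \<notin> {m * (- m - y), m * (b - y)}"
    by (subst AE_density) (auto simp: AE_lborel_singleton intro!: AE_I2 eventually_elim2[OF AE_lborel_singleton AE_lborel_singleton])
  show "(smooth_indicator m b \<circ> s) \<longlonglongrightarrow> smooth_indicator m b y"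
    unfolding comp_def smooth_indicator_def
  proof (rule integral_dominated_convergence[where w="\<lambda>_. 1"])
    show "AE z in std_normal_distribution.
        (\<lambda>n. indicator {-m..b} (s n + z / m) :: real) \<longlonglongrightarrow> indicator {-m..b} (y + z / m)"
      using null
    proof eventually_elim
      case (elim z)
      have "y + z / m \<notin> frontier {-m..b}"
        using elim assms by (auto simp: frontier_def field_simps split: if_splits)
      then have "isCont (indicator {-m..b} :: real \<Rightarrow> real) (y + z / m)"
        by (simp add: isCont_indicator)
      then show ?case
        by (rule isCont_tendsto_compose) (intro tendsto_intros s)
    qed
  qed (auto simp: indicator_le_1)
qed

text \<open>At \<open>y = b\<close> the smoothed value tends to 1/2, the Gaussian mass of the
  nonpositive half-line, so this point has to be excluded.\<close>

lemma smooth_indicator_tendsto: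
  assumes "y \<noteq> b"
  shows "(\<lambda>m. smooth_indicator (real (Suc m)) b y) \<longlonglongrightarrow> indicator {..b} y"
proof -
  interpret real_distribution std_normal_distribution by (rule real_dist_normal_dist)
  have "(\<lambda>m. \<integral>z. indicator {- real (Suc m)..b} (y + z / real (Suc m)) \<partial>std_normal_distribution)
      \<longlonglongrightarrow> (\<integral>z. (indicator {..b} y :: real) \<partial>std_normal_distribution)"
  proof (rule integral_dominated_convergence[where w="\<lambda>_. 1"], goal_cases)
    case 4
    show ?case
    proof (intro AE_I2)
      fix z :: real
      have lim: "(\<lambda>m. y + z / real (Suc m)) \<longlonglongrightarrow> y + 0"
        by (intro tendsto_add tendsto_const LIMSEQ_Suc[OF lim_const_over_n])
      have low: "\<forall>\<^sub>F m in sequentially. - real (Suc m) < y + z / real (Suc m)"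
        by real_asymp
      show "(\<lambda>m. indicator {- real (Suc m)..b} (y + z / real (Suc m))) \<longlonglongrightarrow> (indicator {..b} y :: real)"
      proof (rule tendsto_eventually)
        consider "y < b" | "y > b" using assms by linarith
        then show "\<forall>\<^sub>F m in sequentially.
            indicator {- real (Suc m)..b} (y + z / real (Suc m)) = (indicator {..b} y :: real)"
        proof cases
          case 1
          then have "\<forall>\<^sub>F m in sequentially. y + z / real (Suc m) < b"
            using order_tendstoD(2)[OF lim, of b] by simp
          with low show ?thesis by eventually_elim (use 1 in \<open>auto simp: indicator_def\<close>)
        next
          case 2
          then have "\<forall>\<^sub>F m in sequentially. y + z / real (Suc m) > b"
            using order_tendstoD(1)[OF lim, of b] by simp
          then show ?thesis by eventually_elim (use 2 in \<open>auto simp: indicator_def\<close>)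
        qed
      qed
    qed
  qed (auto simp: indicator_le_1)
  then show ?thesis
    unfolding smooth_indicator_def using prob_space by simp
qed

text \<open>The Gaussian density is a multiple of its own characteristic function. After the
  substitution \<open>z = m * (x - y)\<close> the smoothing kernel is an average of
  \<open>iexp (m * (x - y) * s)\<close> over standard normal \<open>s\<close>, so
  \<open>- m * s\<close> plays the role of the frequency \<open>t\<close>. Hence
  \<open>\<tau>\<close> is normal with standard deviation \<open>m\<close>, and \<open>h\<close> is,
  up to the factor \<open>c\<close>, the Fourier transform of the indicator of
  \<open>{-m..b}\<close>.\<close>

lemma smooth_indicator_Fourier:
  assumes m: "m > 0"
  obtains \<tau> h B where "real_distribution \<tau>" "h \<in> borel_measurable borel" "\<And>t. cmod (h t) \<le> B"
    "\<And>y. complex_of_real (smooth_indicator m b y) = (CLINT t|\<tau>. h t * iexp (t * y))"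
proof -
  interpret N: real_distribution std_normal_distribution by (rule real_dist_normal_dist)
  define L where "L = density lborel (\<lambda>x. ennreal (indicator {-m..b} x))"
  \<comment> \<open>The factor \<open>m\<close> is the Jacobian of \<open>z = m * (x - y)\<close>;
    the rest is the normalisation of the Gaussian density.\<close>
  define c where "c = m / sqrt (2 * pi)"
  define h where "h t = c * (CLINT x|L. iexp (- t * x))" for t
  define \<tau> where "\<tau> = distr std_normal_distribution borel (\<lambda>s. - m * s)"
  have sp: "space L = UNIV" and [measurable_cong]: "sets L = sets borel"
    by (auto simp: L_def)
  interpret L: finite_measure L
  proof (rule finite_measureI)
    have "emeasure L (space L) = (\<integral>\<^sup>+x. indicator {-m..b} x \<partial>lborel)"
      unfolding sp by (simp add: L_def emeasure_density ennreal_indicator)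
    then show "emeasure L (space L) \<noteq> \<infinity>" by (simp add: emeasure_lborel_Icc_eq)
  qed
  interpret LN: pair_sigma_finite L std_normal_distribution ..
  interpret LNf: finite_measure "L \<Otimes>\<^sub>M std_normal_distribution"
    by (intro finite_measure_pair_measure N.finite_measure_axioms L.finite_measure_axioms)
  have "real_distribution \<tau>"
    unfolding \<tau>_def by (rule N.real_distribution_distr) simp
  moreover have h [measurable]: "h \<in> borel_measurable borel"
    unfolding h_def by measurable
  moreover have "cmod (h t) \<le> c * measure L (space L)" for t
  proof -
    have "cmod (CLINT x|L. iexp (- t * x)) \<le> (\<integral>x. cmod (iexp (- t * x)) \<partial>L)"
      by (rule integral_norm_bound)
    also have "\<dots> = measure L (space L)" by simp
    finally have le: "cmod (CLINT x|L. iexp (- t * x)) \<le> measure L (space L)" .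
    have c0: "0 \<le> c" using m by (simp add: c_def)
    show ?thesis
      unfolding h_def norm_mult norm_of_real abs_of_nonneg[OF c0] by (rule mult_left_mono[OF le c0])
  qed
  moreover have "complex_of_real (smooth_indicator m b y) = (CLINT t|\<tau>. h t * iexp (t * y))" for y
  proof -
    have dens: "complex_of_real (std_normal_density u)
        = 1 / sqrt (2 * pi) * (CLINT s|std_normal_distribution. iexp (u * s))" for u
      using fun_cong[OF char_std_normal_distribution, of u]
      by (simp add: char_def std_normal_density_def)
    have "smooth_indicator m b y = (\<integral>z. std_normal_density z * indicator {-m..b} (y + z / m) \<partial>lborel)"
      unfolding smooth_indicator_def by (subst integral_density) auto
    also have "\<dots> = m * (\<integral>x. std_normal_density (- m * y + m * x) * indicator {-m..b} (y + (- m * y + m * x) / m) \<partial>lborel)"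
      using m by (subst lborel_integral_real_affine[where c=m and t="- m * y"]) auto
    also have "(\<lambda>x. y + (- m * y + m * x) / m) = (\<lambda>x. x)"
      using m by (auto simp: field_simps)
    also have "m * (\<integral>x. std_normal_density (- m * y + m * x) * indicator {-m..b} x \<partial>lborel)
        = m * (\<integral>x. std_normal_density (- m * y + m * x) \<partial>L)"
      unfolding L_def by (subst integral_density) (auto simp: mult.commute)
    finally have "complex_of_real (smooth_indicator m b y)
        = m * (\<integral>x. complex_of_real (std_normal_density (- m * y + m * x)) \<partial>L)"
      by simp
    also have "\<dots> = m * (\<integral>x. 1 / sqrt (2 * pi) *
        (CLINT s|std_normal_distribution. iexp ((- m * y + m * x) * s)) \<partial>L)"
      by (simp only: dens)
    also have "\<dots> = c * (\<integral>x. (CLINT s|std_normal_distribution. iexp ((- m * y + m * x) * s)) \<partial>L)"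
      by (simp add: c_def del: of_real_mult)
    also have "(\<integral>x. (CLINT s|std_normal_distribution. iexp ((- m * y + m * x) * s)) \<partial>L)
        = (\<integral>s. (CLINT x|L. iexp ((- m * y + m * x) * s)) \<partial>std_normal_distribution)"
      by (intro LN.Fubini_integral[symmetric] LNf.integrable_const_bound[where B=1])
         (auto simp: split_beta' simp del: of_real_mult)
    also have "\<dots> = (\<integral>s. (CLINT x|L. iexp (- (- m * s) * x)) * iexp ((- m * s) * y) \<partial>std_normal_distribution)"
    proof (intro Bochner_Integration.integral_cong refl)
      fix s
      have "iexp ((- m * y + m * x) * s) = iexp (- (- m * s) * x) * iexp ((- m * s) * y)" for x
        by (simp add: exp_add[symmetric] algebra_simps)
      then show "(CLINT x|L. iexp ((- m * y + m * x) * s))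
          = (CLINT x|L. iexp (- (- m * s) * x)) * iexp ((- m * s) * y)"
        by (simp only: integral_mult_left_zero)
    qed
    also have "c * \<dots> = (\<integral>s. h (- m * s) * iexp ((- m * s) * y) \<partial>std_normal_distribution)"
      unfolding h_def by (simp only: mult.assoc integral_mult_right_zero)
    also have "\<dots> = (CLINT t|\<tau>. h t * iexp (t * y))"
      unfolding \<tau>_def by (subst integral_distr) auto
    finally show ?thesis .
  qed
  ultimately show thesis by (rule that)
qed

subsection \<open>Moments of random distribution functions\<close>

context random_law begin

definition cdf_moment :: "nat \<Rightarrow> real \<Rightarrow> real" where
  "cdf_moment j y = (\<integral>\<omega>. cdf (law \<omega>) y ^ j \<partial>P)"

lemma cdf_moment_eq: "cdf_moment j y = (\<integral>\<omega>. (\<integral>u. indicator {..y} u \<partial>law \<omega>) ^ j \<partial>P)"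
  unfolding cdf_moment_def by (intro Bochner_Integration.integral_cong refl) (simp only: cdf_law_eq)

lemma cdf_law_nonneg: "0 \<le> cdf (law \<omega>) y"
  by (simp add: cdf_def)

lemma cdf_law_le_1: "\<omega> \<in> space P \<Longrightarrow> cdf (law \<omega>) y \<le> 1"
  using real_distribution_law[of \<omega>] by (simp add: cdf_def real_distribution_def prob_space.prob_le_1)

lemma integrable_cdf_law_power: "integrable P (\<lambda>\<omega>. cdf (law \<omega>) y ^ j)"
proof -
  have "(\<lambda>\<omega>. (\<integral>u. indicator {..y} u \<partial>law \<omega>) ^ j :: real) \<in> borel_measurable P"
    by measurable
  then have "(\<lambda>\<omega>. cdf (law \<omega>) y ^ j) \<in> borel_measurable P"
    by (subst measurable_cong) (auto simp: cdf_law_eq)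
  then show ?thesis
    using cdf_law_nonneg cdf_law_le_1
    by (intro P.integrable_const_bound[where B=1]) (auto simp: power_abs abs_of_nonneg intro!: power_le_one AE_I2)
qed

lemma cdf_moment_nonneg: "0 \<le> cdf_moment j y"
  unfolding cdf_moment_def using cdf_law_nonneg by (intro Bochner_Integration.integral_nonneg) auto

lemma cdf_moment_le_1: "cdf_moment j y \<le> 1"
  unfolding cdf_moment_def using cdf_law_nonneg cdf_law_le_1
  by (intro P.integral_le_const integrable_cdf_law_power) (auto intro!: power_le_one AE_I2)

lemma mono_cdf_moment: "mono (cdf_moment j)"
proof (rule monoI)
  fix x y :: real assume "x \<le> y"
  then show "cdf_moment j x \<le> cdf_moment j y"
    unfolding cdf_moment_def
    using real_distribution_law[THEN real_distribution.finite_borel_measure_M,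
        THEN finite_borel_measure.cdf_nondecreasing] cdf_law_nonneg
    by (intro integral_mono integrable_cdf_law_power power_mono) auto
qed

text \<open>This inequality is used for four kinds of \<open>h\<close>: the constants 0 and 1 give
  the behaviour at the two ends of the line, another half-line indicator gives continuity, and a
  smoothed indicator gives the approximation error.\<close>

lemma cdf_moment_approx:
  assumes "h \<in> borel_measurable borel" and "\<And>y. \<bar>h y\<bar> \<le> 1"
  shows "\<bar>cdf_moment j y - (\<integral>\<omega>. (\<integral>u. h u \<partial>law \<omega>) ^ j \<partial>P)\<bar>
    \<le> j * (\<integral>u. \<bar>indicator {..y} u - h u\<bar> \<partial>mean_law)"
  unfolding cdf_moment_eq using assms by (intro integral_law_power_diff_le) (auto simp: indicator_le_1)

text \<open>Two half-line indicators differ exactly between the two points, so their distance is the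
  mean-law mass there. The moments thus inherit continuity from the mean distribution
  function.\<close>

lemma cdf_moment_diff_le: "\<bar>cdf_moment j x - cdf_moment j y\<bar> \<le> j * \<bar>cdf mean_law x - cdf mean_law y\<bar>"
proof -
  interpret L: real_distribution mean_law by (rule real_distribution_mean_law)
  have int: "(\<integral>u. \<bar>indicator {..x} u - indicator {..y} u\<bar> \<partial>mean_law) = cdf mean_law y - cdf mean_law x"
    if "x \<le> y" for x y :: real
  proof (cases "x = y")
    case False
    have "(\<integral>u. \<bar>indicator {..x} u - indicator {..y} u\<bar> \<partial>mean_law) = (\<integral>u. (indicator {x<..y} u :: real) \<partial>mean_law)"
      using that by (intro Bochner_Integration.integral_cong) (auto split: split_indicator)
    then show ?thesis using that False by (simp add: L.cdf_diff_eq)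
  qed simp
  have le: "\<bar>cdf_moment j x - cdf_moment j y\<bar> \<le> j * \<bar>cdf mean_law x - cdf mean_law y\<bar>" if "x \<le> y" for x y
  proof -
    have "\<bar>cdf_moment j x - cdf_moment j y\<bar> \<le> j * (\<integral>u. \<bar>indicator {..x} u - indicator {..y} u\<bar> \<partial>mean_law)"
      by (subst (2) cdf_moment_eq, rule cdf_moment_approx) (auto simp: indicator_le_1)
    then show ?thesis
      using L.cdf_nondecreasing[OF that] by (simp add: int[OF that] abs_minus_commute)
  qed
  show ?thesis
    using le[of x y] le[of y x] by (cases "x \<le> y") (auto simp: abs_minus_commute)
qed

text \<open>Comparison with \<open>h = 0\<close> bounds the moment by \<open>j\<close> times the
  mean distribution function. The zeroth moment is constantly 1, hence
  \<open>1 \<le> j\<close>.\<close>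

lemma cdf_moment_tendsto_0:
  assumes "1 \<le> j" shows "(cdf_moment j \<longlongrightarrow> 0) at_bot"
proof -
  interpret L: real_distribution mean_law by (rule real_distribution_mean_law)
  have "cdf_moment j y \<le> j * cdf mean_law y" for y
    using cdf_moment_approx[of "\<lambda>_. 0" j y] assms cdf_moment_nonneg[of j y]
    by (simp add: zero_power cdf_def)
  then show ?thesis
    using L.cdf_lim_at_bot cdf_moment_nonneg
    by (intro tendsto_sandwich[of "\<lambda>_. 0" "cdf_moment j" at_bot "\<lambda>y. j * cdf mean_law y"])
       (auto intro!: tendsto_eq_intros)
qed

text \<open>Comparison with \<open>h = 1\<close> yields an averaged Bernoulli inequality,
  \<open>1 - j * (1 - F)\<close> as a lower bound with \<open>F\<close> the mean distribution
  function.\<close>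

lemma cdf_moment_tendsto_1: "(cdf_moment j \<longlongrightarrow> 1) at_top"
proof -
  interpret L: real_distribution mean_law by (rule real_distribution_mean_law)
  have "1 - j * (1 - cdf mean_law y) \<le> cdf_moment j y" for y
  proof -
    have "(\<integral>\<omega>. (\<integral>u. 1 \<partial>law \<omega>) ^ j \<partial>P) = (\<integral>\<omega>. (1 :: real) \<partial>P)"
    proof (intro Bochner_Integration.integral_cong refl)
      fix \<omega> assume "\<omega> \<in> space P"
      then interpret l: real_distribution "law \<omega>" by (rule real_distribution_law)
      show "(\<integral>u. 1 \<partial>law \<omega>) ^ j = (1 :: real)" using l.prob_space by simp
    qed
    moreover have "(\<integral>u. \<bar>indicator {..y} u - 1 :: real\<bar> \<partial>mean_law) = (\<integral>u. 1 - indicator {..y} u \<partial>mean_law)"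
      by (intro Bochner_Integration.integral_cong) (auto split: split_indicator)
    moreover have "\<dots> = 1 - cdf mean_law y"
      using L.prob_space by (subst Bochner_Integration.integral_diff)
        (auto simp: cdf_def indicator_le_1 intro!: L.integrable_const_bound[where B=1])
    ultimately show ?thesis
      using cdf_moment_approx[of "\<lambda>_. 1" j y] cdf_moment_le_1[of j y] P.prob_space by simp
  qed
  moreover have "((\<lambda>y. 1 - j * (1 - cdf mean_law y)) \<longlongrightarrow> 1) at_top"
    using L.cdf_lim_at_top_prob by (auto intro!: tendsto_eq_intros)
  ultimately show ?thesis
    using cdf_moment_le_1
    by (intro tendsto_sandwich[of "\<lambda>y. 1 - j * (1 - cdf mean_law y)" "cdf_moment j" at_top "\<lambda>_. 1"]) auto
qed

lemma isCont_cdf_moment: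
  assumes "measure mean_law {y} = 0"
  shows "isCont (cdf_moment j) y"
proof -
  interpret L: real_distribution mean_law by (rule real_distribution_mean_law)
  have "isCont (cdf mean_law) y" using assms by (simp add: L.isCont_cdf)
  then have "((\<lambda>x. j * \<bar>cdf mean_law x - cdf mean_law y\<bar>) \<longlongrightarrow> 0) (at y)"
    by (auto simp: isCont_def intro!: tendsto_eq_intros)
  then have "((\<lambda>x. cdf_moment j x - cdf_moment j y) \<longlongrightarrow> 0) (at y)"
    by (rule Lim_null_comparison[rotated]) (auto simp: cdf_moment_diff_le)
  then show ?thesis
    by (simp add: isCont_def LIM_zero_iff)
qed

end

text \<open>The mixed moments are bounded by 1 and \<open>h\<close> by \<open>B\<close>, so their
  pointwise convergence passes through the integral over the j-fold product of \<open>\<tau>\<close>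
  by dominated convergence.\<close>

lemma integral_Fourier_power_tendsto:
  fixes g :: "real \<Rightarrow> real" and h :: "real \<Rightarrow> complex"
  assumes R: "\<And>n. random_law (P n) (Q n) (f n)" and R0: "random_law P0 Q0 f0"
    and conv: "\<And>t. (\<lambda>n. \<integral>\<omega>. (\<Prod>i<j. char (random_law.law (Q n) (f n) \<omega>) (t i)) \<partial>P n)
      \<longlonglongrightarrow> (\<integral>\<omega>. (\<Prod>i<j. char (random_law.law Q0 f0 \<omega>) (t i)) \<partial>P0)"
    and \<tau>: "real_distribution \<tau>" and h [measurable]: "h \<in> borel_measurable borel"
    and B: "\<And>t. cmod (h t) \<le> B" and g: "g \<in> borel_measurable borel"
    and g_eq: "\<And>y. complex_of_real (g y) = (CLINT t|\<tau>. h t * iexp (t * y))"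
  shows "(\<lambda>n. \<integral>\<omega>. (\<integral>y. g y \<partial>random_law.law (Q n) (f n) \<omega>) ^ j \<partial>P n)
    \<longlonglongrightarrow> (\<integral>\<omega>. (\<integral>y. g y \<partial>random_law.law Q0 f0 \<omega>) ^ j \<partial>P0)"
proof -
  interpret R: random_law "P n" "Q n" "f n" for n by (rule R)
  interpret R0: random_law P0 Q0 f0 by (rule R0)
  interpret \<tau>: real_distribution \<tau> by (rule \<tau>)
  let ?T = "Pi\<^sub>M {..<j} (\<lambda>_. \<tau>)"
  interpret T: prob_space ?T by (intro prob_space_PiM \<tau>.prob_space_axioms)
  have B0: "0 \<le> B" using B[of 0] norm_ge_zero by (rule order_trans[rotated])
  note F = random_law.integral_Fourier_power[OF _ \<tau> h B g g_eq, where j=j]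
  let ?c = "\<lambda>P Q f t. \<integral>\<omega>. (\<Prod>i<j. char (random_law.law Q f \<omega>) (t i)) \<partial>P"
  have le: "cmod (?c P Q f t) \<le> 1" if "random_law P Q f" for P :: "'x measure" and Q :: "'y measure" and f t
  proof -
    interpret S: random_law P Q f by fact
    have "cmod (?c P Q f t) \<le> (\<integral>\<omega>. cmod (\<Prod>i<j. char (S.law \<omega>) (t i)) \<partial>P)"
      by (rule integral_norm_bound)
    also have "\<dots> \<le> (\<integral>\<omega>. 1 \<partial>P)"
    proof (rule integral_mono')
      fix \<omega> assume "\<omega> \<in> space P"
      then show "cmod (\<Prod>i<j. char (S.law \<omega>) (t i)) \<le> 1"
        using real_distribution.cmod_char_le_1[OF S.real_distribution_law]
        by (auto simp: prod_norm[symmetric] intro!: prod_le_1)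
    qed auto
    finally show ?thesis using S.P.prob_space by simp
  qed
  \<comment> \<open>The types are left general because the fact is applied both to the approximating
    laws and to the limit, which may live over different types.\<close>
  have meas: "?c P Q f \<in> borel_measurable ?T" if "random_law P Q f" for P :: "'x measure" and Q :: "'y measure" and f
  proof -
    interpret S: random_law P Q f by fact
    have [measurable]: "(\<lambda>(t, \<omega>). char (S.law \<omega>) (t i)) \<in> borel_measurable (?T \<Otimes>\<^sub>M P)"
      if "i < j" for i
      using S.borel_measurable_char_law_component[OF \<tau>.events_eq_borel, of i "{..<j}"] that by simp
    show ?thesis by measurable
  qed
  have [measurable]: "(\<lambda>t. h (t i)) \<in> borel_measurable ?T" if "i \<in> {..<j}" for i
    using that by measurable
  have "(\<lambda>n. \<integral>t. (\<Prod>i<j. h (t i)) * ?c (P n) (Q n) (f n) t \<partial>?T)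
      \<longlonglongrightarrow> (\<integral>t. (\<Prod>i<j. h (t i)) * ?c P0 Q0 f0 t \<partial>?T)"
  proof (rule integral_dominated_convergence[where w="\<lambda>_. B ^ j * 1"], goal_cases)
    case 1 show ?case using meas[OF R0] by measurable
    case 2 show ?case using meas[OF R] by measurable
    case 4 show ?case by (intro AE_I2 tendsto_intros conv)
    case 5
    have "cmod (\<Prod>i<j. h (t i)) \<le> B ^ j" for t
    proof -
      have "(\<Prod>i<j. cmod (h (t i))) \<le> (\<Prod>i<j. B)" using B by (intro prod_mono) auto
      then show ?thesis by (simp add: prod_norm)
    qed
    then show ?case using B0 le[OF R]
      by (intro AE_I2) (auto simp: norm_mult simp del: mult_1_right intro!: mult_mono)
  qed simp
  then have "(\<lambda>n. complex_of_real (\<integral>\<omega>. (\<integral>y. g y \<partial>R.law n \<omega>) ^ j \<partial>P n))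
      \<longlonglongrightarrow> complex_of_real (\<integral>\<omega>. (\<integral>y. g y \<partial>R0.law \<omega>) ^ j \<partial>P0)"
    unfolding F[OF R] F[OF R0] .
  then show ?thesis by (rule tendsto_of_real_iff[THEN iffD1])
qed

text \<open>The convergence hypothesis is used twice: with one factor it is convergence of the
  characteristic functions of the mean laws, and with \<open>j\<close> factors it drives the Fourier
  step. The error at a point splits into three parts of size \<open>e / 3\<close>: smoothing before
  the limit, the Fourier step, and smoothing in the limit.\<close>

theorem uniform_limit_cdf_moment:
  assumes R: "\<And>n. random_law (P n) (Q n) (f n)" and R0: "random_law P0 Q0 f0"
    and conv: "\<And>(i::nat) t. (\<lambda>n. \<integral>\<omega>. (\<Prod>l<i. char (random_law.law (Q n) (f n) \<omega>) (t l)) \<partial>P n)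
      \<longlonglongrightarrow> (\<integral>\<omega>. (\<Prod>l<i. char (random_law.law Q0 f0 \<omega>) (t l)) \<partial>P0)"
    and atomless: "\<And>y. measure (random_law.mean_law P0 Q0 f0) {y} = 0"
    and j: "1 \<le> j"
  shows "uniform_limit UNIV (\<lambda>n. random_law.cdf_moment (P n) (Q n) (f n) j)
    (random_law.cdf_moment P0 Q0 f0 j) sequentially"
proof -
  interpret R: random_law "P n" "Q n" "f n" for n by (rule R)
  interpret R0: random_law P0 Q0 f0 by (rule R0)
  interpret L0: real_distribution R0.mean_law by (rule R0.real_distribution_mean_law)
  have null: "emeasure R0.mean_law {y} = 0" for y
    using atomless[of y] by (simp add: L0.emeasure_eq_measure)
  have weak: "weak_conv_m R.mean_law R0.mean_law"
  proof (rule levy_continuity)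
    fix t
    show "(\<lambda>n. char (R.mean_law n) t) \<longlonglongrightarrow> char R0.mean_law t"
      using conv[where i=1 and t="\<lambda>_. t"] by (simp add: R.char_mean_law R0.char_mean_law)
  qed (rule R.real_distribution_mean_law R0.real_distribution_mean_law)+
  let ?g = "\<lambda>m. smooth_indicator (real (Suc m))"
  have diff: "\<bar>\<bar>indicator {..b} u - ?g m b u\<bar>\<bar> \<le> 1" for m b u
    using smooth_indicator_nonneg[of "Suc m" b u] smooth_indicator_le_1[of "Suc m" b u]
    by (auto split: split_indicator)
  have lim: "(\<lambda>n. R.cdf_moment n j b) \<longlonglongrightarrow> R0.cdf_moment j b" for b
  proof (rule tendstoI)
    fix e :: real assume e: "e > 0"
    define d where "d = e / (3 * real j)"
    have d: "d > 0" "j * d = e / 3" using e j by (auto simp: d_def)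
    have "(\<lambda>m. \<integral>u. \<bar>indicator {..b} u - ?g m b u\<bar> \<partial>R0.mean_law) \<longlonglongrightarrow> (\<integral>u. 0 \<partial>R0.mean_law)"
    proof (rule integral_dominated_convergence[where w="\<lambda>_. 1"])
      have "AE u in R0.mean_law. u \<noteq> b"
        using null[of b] by (intro AE_I[of _ _ "{b}"]) auto
      then show "AE u in R0.mean_law. (\<lambda>m. \<bar>indicator {..b} u - ?g m b u\<bar>) \<longlonglongrightarrow> 0"
      proof eventually_elim
        case (elim u)
        from tendsto_diff[OF tendsto_const smooth_indicator_tendsto[OF elim], of "indicator {..b} u"]
        show ?case by (auto dest: tendsto_rabs_zero)
      qed
    qed (use diff in auto)
    then have "\<forall>\<^sub>F m in sequentially. (\<integral>u. \<bar>indicator {..b} u - ?g m b u\<bar> \<partial>R0.mean_law) < d"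
      using d(1) by (auto dest: order_tendstoD)
    \<comment> \<open>The smoothing level is fixed from the limit law alone. Weak convergence then
      carries the bound over to all large \<open>n\<close>: the error function is discontinuous at
      most at \<open>b\<close>, which has mass zero in the limit.\<close>
    then obtain m where m: "(\<integral>u. \<bar>indicator {..b} u - ?g m b u\<bar> \<partial>R0.mean_law) < d"
      by (auto dest: eventually_happens)
    have "(\<lambda>n. \<integral>u. \<bar>indicator {..b} u - ?g m b u\<bar> \<partial>R.mean_law n)
        \<longlonglongrightarrow> (\<integral>u. \<bar>indicator {..b} u - ?g m b u\<bar> \<partial>R0.mean_law)"
    proof (rule weak_conv_imp_bdd_ae_continuous_conv[OF R.real_distribution_mean_law
          R0.real_distribution_mean_law weak, where B=1])
      have "{u. \<not> isCont (\<lambda>u. \<bar>indicator {..b} u - ?g m b u\<bar>) u} \<subseteq> {b}"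
      proof safe
        fix u assume *: "\<not> isCont (\<lambda>u. \<bar>indicator {..b} u - ?g m b u\<bar>) u"
        show "u = b"
        proof (rule ccontr)
          assume "u \<noteq> b"
          then have "isCont (indicator {..b} :: real \<Rightarrow> real) u"
            by (auto simp: isCont_indicator frontier_def)
          then have "isCont (\<lambda>u. \<bar>indicator {..b} u - ?g m b u\<bar>) u"
            by (intro continuous_intros isCont_smooth_indicator) auto
          with * show False by contradiction
        qed
      qed
      then show "emeasure R0.mean_law {u. \<not> isCont (\<lambda>u. \<bar>indicator {..b} u - ?g m b u\<bar>) u} = 0"
        using null[of b] emeasure_mono[of _ "{b}" R0.mean_law] by (metis L0.events_eq_borel borel_closed closed_singleton le_zero_eq)
    qed (use diff in auto)
    then have near: "\<forall>\<^sub>F n in sequentially. (\<integral>u. \<bar>indicator {..b} u - ?g m b u\<bar> \<partial>R.mean_law n) < d"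
      using m by (rule order_tendstoD)
    obtain \<tau> h B where F: "real_distribution \<tau>" "h \<in> borel_measurable borel" "\<And>t. cmod (h t) \<le> B"
        "\<And>y. complex_of_real (?g m b y) = (CLINT t|\<tau>. h t * iexp (t * y))"
      by (rule smooth_indicator_Fourier[of "real (Suc m)" b, OF of_nat_0_less_iff[THEN iffD2, OF zero_less_Suc]]) (rule that)
    have "(\<lambda>n. \<integral>\<omega>. (\<integral>y. ?g m b y \<partial>R.law n \<omega>) ^ j \<partial>P n)
        \<longlonglongrightarrow> (\<integral>\<omega>. (\<integral>y. ?g m b y \<partial>R0.law \<omega>) ^ j \<partial>P0)"
      by (rule integral_Fourier_power_tendsto[OF R R0 conv F(1-3) _ F(4)]) simp
    from tendstoD[OF this, of "e/3"] e
    have "\<forall>\<^sub>F n in sequentially. \<bar>(\<integral>\<omega>. (\<integral>y. ?g m b y \<partial>R.law n \<omega>) ^ j \<partial>P n)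
        - (\<integral>\<omega>. (\<integral>y. ?g m b y \<partial>R0.law \<omega>) ^ j \<partial>P0)\<bar> < e / 3"
      by (simp add: dist_real_def)
    with near show "\<forall>\<^sub>F n in sequentially. dist (R.cdf_moment n j b) (R0.cdf_moment j b) < e"
    proof eventually_elim
      case (elim n)
      have g1: "\<bar>?g m b y\<bar> \<le> 1" for y
        using smooth_indicator_nonneg[of "Suc m" b y] smooth_indicator_le_1[of "Suc m" b y] by simp
      have "\<bar>R.cdf_moment n j b - (\<integral>\<omega>. (\<integral>y. ?g m b y \<partial>R.law n \<omega>) ^ j \<partial>P n)\<bar> \<le> e / 3"
        using R.cdf_moment_approx[where h="?g m b" and j=j and y=b and n=n] g1 elim(1) d(2)
          mult_left_mono[OF less_imp_le[OF elim(1)], of "real j"]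
        by (auto simp del: of_nat_Suc)
      moreover have "\<bar>R0.cdf_moment j b - (\<integral>\<omega>. (\<integral>y. ?g m b y \<partial>R0.law \<omega>) ^ j \<partial>P0)\<bar> \<le> e / 3"
        using R0.cdf_moment_approx[where h="?g m b" and j=j and y=b] g1 m d(2)
          mult_left_mono[OF less_imp_le[OF m], of "real j"]
        by (auto simp del: of_nat_Suc)
      ultimately show ?case using elim(2) unfolding dist_real_def by linarith
    qed
  qed
  show ?thesis
    by (intro Polya_uniform_limit lim R.mono_cdf_moment R.cdf_moment_nonneg R.cdf_moment_le_1
        R0.cdf_moment_tendsto_0 R0.cdf_moment_tendsto_1 R0.isCont_cdf_moment atomless j)
qed

subsection \<open>Convergence in probability and Gram matrices\<close>

lemma tendsto_in_probD:
  "tendsto_in_prob M Z c \<Longrightarrow> 0 < e \<Longrightarrow>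
    (\<lambda>n. measure M {\<omega> \<in> space M. e < \<bar>Z n \<omega> - c\<bar>}) \<longlonglongrightarrow> 0"
  by (simp add: tendsto_in_prob_def)

lemma tendsto_in_prob_add:
  assumes M: "prob_space M"
    and [measurable]: "\<And>n. Z n \<in> borel_measurable M" "\<And>n. W n \<in> borel_measurable M"
    and Z: "tendsto_in_prob M Z a" and W: "tendsto_in_prob M W b"
  shows "tendsto_in_prob M (\<lambda>n \<omega>. Z n \<omega> + W n \<omega>) (a + b)"
  unfolding tendsto_in_prob_def
proof safe
  interpret prob_space M by (rule M)
  fix e :: real assume e: "e > 0"
  let ?A = "\<lambda>n. {\<omega> \<in> space M. e / 2 < \<bar>Z n \<omega> - a\<bar>}" and ?B = "\<lambda>n. {\<omega> \<in> space M. e / 2 < \<bar>W n \<omega> - b\<bar>}"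
  have lim: "(\<lambda>n. measure M (?A n) + measure M (?B n)) \<longlonglongrightarrow> 0 + 0"
    by (rule tendsto_add[OF tendsto_in_probD[OF Z] tendsto_in_probD[OF W]]) (use e in simp_all)
  have split: "e / 2 < \<bar>z - a\<bar> \<or> e / 2 < \<bar>w - b\<bar>" if "e < \<bar>z + w - (a + b)\<bar>" for z w
  proof (rule ccontr)
    assume "\<not> ?thesis"
    then have "\<bar>z - a\<bar> + \<bar>w - b\<bar> \<le> e" by simp
    then show False using that by linarith
  qed
  have "measure M {\<omega> \<in> space M. e < \<bar>Z n \<omega> + W n \<omega> - (a + b)\<bar>} \<le> measure M (?A n) + measure M (?B n)" for n
  proof -
    have "measure M {\<omega> \<in> space M. e < \<bar>Z n \<omega> + W n \<omega> - (a + b)\<bar>} \<le> measure M (?A n \<union> ?B n)"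
      by (rule finite_measure_mono) (use split in blast, measurable)
    also have "\<dots> \<le> measure M (?A n) + measure M (?B n)"
      by (rule measure_Un_le) auto
    finally show ?thesis .
  qed
  then show "(\<lambda>n. measure M {\<omega> \<in> space M. e < \<bar>Z n \<omega> + W n \<omega> - (a + b)\<bar>}) \<longlonglongrightarrow> 0"
    by (intro tendsto_sandwich[OF always_eventually always_eventually tendsto_const lim[unfolded add_0]]
        allI measure_nonneg)
qed

lemma tendsto_in_prob_cmult:
  assumes "tendsto_in_prob M Z a"
  shows "tendsto_in_prob M (\<lambda>n \<omega>. c * Z n \<omega>) (c * a)"
  unfolding tendsto_in_prob_def
proof safe
  fix e :: real assume e: "e > 0"
  show "(\<lambda>n. measure M {\<omega> \<in> space M. e < \<bar>c * Z n \<omega> - c * a\<bar>}) \<longlonglongrightarrow> 0"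
  proof (cases "c = 0")
    case False
    have "\<bar>c * Z n \<omega> - c * a\<bar> = \<bar>c\<bar> * \<bar>Z n \<omega> - a\<bar>" for n \<omega>
      by (simp add: abs_mult[symmetric] right_diff_distrib)
    then have "(e < \<bar>c * Z n \<omega> - c * a\<bar>) = (e / \<bar>c\<bar> < \<bar>Z n \<omega> - a\<bar>)" for n \<omega>
      using False by (simp add: field_simps)
    then show ?thesis
      using assms e False by (simp add: tendsto_in_prob_def)
  qed (use e in simp)
qed

lemma tendsto_in_prob_sum:
  assumes M: "prob_space M" and I: "finite I"
    and meas: "\<And>i n. i \<in> I \<Longrightarrow> Z i n \<in> borel_measurable M"
    and Z: "\<And>i. i \<in> I \<Longrightarrow> tendsto_in_prob M (Z i) (a i)"
  shows "tendsto_in_prob M (\<lambda>n \<omega>. \<Sum>i\<in>I. Z i n \<omega>) (\<Sum>i\<in>I. a i)"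
  using I meas Z
proof (induction I rule: finite_induct)
  case empty
  then show ?case by (simp add: tendsto_in_prob_def)
next
  case (insert i I)
  then show ?case by (auto intro!: tendsto_in_prob_add M)
qed

text \<open>Near \<open>c\<close> continuity bounds the change of \<open>g\<close>; on the remaining
  event, of vanishing probability, \<open>2 * B\<close> does.\<close>

lemma tendsto_in_prob_imp_integral_tendsto:
  fixes g :: "real \<Rightarrow> real"
  assumes M: "prob_space M" and [measurable]: "\<And>n. Z n \<in> borel_measurable M"
    and Z: "tendsto_in_prob M Z c"
    and cont: "\<And>x. isCont g x" and B: "\<And>x. \<bar>g x\<bar> \<le> B"
  shows "(\<lambda>n. \<integral>\<omega>. g (Z n \<omega>) \<partial>M) \<longlonglongrightarrow> g c"
proof (rule tendstoI)
  interpret prob_space M by (rule M)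
  fix e :: real assume e: "e > 0"
  have [measurable]: "g \<in> borel_measurable borel"
    using cont by (intro borel_measurable_continuous_onI continuous_at_imp_continuous_on) auto
  have B0: "0 \<le> B" using B[of 0] by simp
  obtain d where d: "d > 0" "\<And>x. \<bar>x - c\<bar> < d \<Longrightarrow> \<bar>g x - g c\<bar> < e / 2"
    using cont[of c, unfolded continuous_at_eps_delta, rule_format, of "e/2"] e
    unfolding dist_real_def by auto
  \<comment> \<open>The cut is at \<open>d / 2\<close> so that the complement, given by a weak
    inequality, satisfies the strict bound by \<open>d\<close>.\<close>
  let ?A = "\<lambda>n. {\<omega> \<in> space M. d / 2 < \<bar>Z n \<omega> - c\<bar>}"
  have "(\<lambda>n. 2 * B * measure M (?A n)) \<longlonglongrightarrow> 2 * B * 0"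
    by (rule tendsto_mult[OF tendsto_const tendsto_in_probD[OF Z]]) (use d(1) in simp)
  then have "\<forall>\<^sub>F n in sequentially. 2 * B * measure M (?A n) < e / 2"
    using e by (intro order_tendstoD(2)) auto
  then show "\<forall>\<^sub>F n in sequentially. dist (\<integral>\<omega>. g (Z n \<omega>) \<partial>M) (g c) < e"
  proof eventually_elim
    case (elim n)
    have int: "integrable M (\<lambda>\<omega>. g (Z n \<omega>))"
      using B by (intro integrable_const_bound[where B=B]) auto
    have intA: "integrable M (indicator (?A n) :: 'a \<Rightarrow> real)"
      by (intro integrable_const_bound[where B=1]) (auto simp: indicator_le_1)
    have "\<bar>(\<integral>\<omega>. g (Z n \<omega>) \<partial>M) - g c\<bar> = \<bar>\<integral>\<omega>. g (Z n \<omega>) - g c \<partial>M\<bar>"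
      using int prob_space by (subst Bochner_Integration.integral_diff) auto
    also have "\<dots> \<le> (\<integral>\<omega>. \<bar>g (Z n \<omega>) - g c\<bar> \<partial>M)"
      by (rule integral_abs_bound)
    also have "\<dots> \<le> (\<integral>\<omega>. e / 2 + 2 * B * indicator (?A n) \<omega> \<partial>M)"
    proof (intro integral_mono)
      fix \<omega> assume \<omega>: "\<omega> \<in> space M"
      show "\<bar>g (Z n \<omega>) - g c\<bar> \<le> e / 2 + 2 * B * indicator (?A n) \<omega>"
      proof (cases "\<omega> \<in> ?A n")
        case True
        then show ?thesis using B[of "Z n \<omega>"] B[of c] e by simp
      next
        case False
        then show ?thesis using d(1) d(2)[of "Z n \<omega>"] \<omega> by simp
      qed
    qed (use int in \<open>auto intro!: Bochner_Integration.integrable_add integrable_mult_right intA simp del: less_divide_eq_numeral1 divide_less_eq_numeral1\<close>)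
    also have "\<dots> = e / 2 + 2 * B * measure M (?A n)"
      using prob_space intA by (subst Bochner_Integration.integral_add) (auto simp del: less_divide_eq_numeral1 divide_less_eq_numeral1)
    also have "\<dots> < e" using elim by simp
    finally show ?case by (simp add: dist_real_def)
  qed
qed

section \<open>Inner products and the quadratic form of a Gram matrix\<close>

lemma measurable_vdot [measurable (raw)]:
  assumes [measurable]: "X \<in> M \<rightarrow>\<^sub>M Rn d" "Y \<in> M \<rightarrow>\<^sub>M Rn d"
  shows "(\<lambda>\<omega>. vdot d (X \<omega>) (Y \<omega>)) \<in> borel_measurable M"
proof -
  have [measurable]: "(\<lambda>\<omega>. Z \<omega> i) \<in> borel_measurable M" if "i < d" "Z \<in> M \<rightarrow>\<^sub>M Rn d" for Z i
    using measurable_compose[OF that(2)[unfolded Rn_def] measurable_component_singleton[of i]] that(1)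
    by simp
  show ?thesis unfolding vdot_def by (intro borel_measurable_sum borel_measurable_times) auto
qed

lemma vnorm_power2: "(vnorm d x)\<^sup>2 = vdot d x x"
  by (simp add: vnorm_def vdot_def L2_set_def sum_nonneg power2_eq_square[symmetric])

lemma vdot_commute: "vdot d x y = vdot d y x"
  by (simp add: vdot_def mult.commute)

lemma vdot_sum_left:
  "vdot d (\<lambda>i\<in>{..<d}. \<Sum>l\<in>L. t l * x l i) y = (\<Sum>l\<in>L. t l * vdot d (x l) y)"
proof -
  have "vdot d (\<lambda>i\<in>{..<d}. \<Sum>l\<in>L. t l * x l i) y = (\<Sum>i<d. \<Sum>l\<in>L. t l * x l i * y i)"
    unfolding vdot_def by (intro sum.cong refl) (simp add: sum_distrib_right)
  also have "\<dots> = (\<Sum>l\<in>L. \<Sum>i<d. t l * x l i * y i)" by (rule sum.swap)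
  finally show ?thesis by (simp add: vdot_def sum_distrib_left mult.assoc)
qed

lemma vnorm_sum_power2:
  "(vnorm d (\<lambda>i\<in>{..<d}. \<Sum>l\<in>L. t l * x l i))\<^sup>2 = (\<Sum>l\<in>L. \<Sum>r\<in>L. t l * t r * vdot d (x l) (x r))"
  unfolding vnorm_power2
  by (simp only: vdot_sum_left vdot_commute[of d _ "\<lambda>i\<in>{..<d}. _ i"])
     (simp add: vdot_commute[of d _ "\<lambda>i\<in>{..<d}. _ i"] vdot_sum_left sum_distrib_left vdot_commute mult_ac)

section \<open>Entries of the Gram matrix of independent copies\<close>

lemma prob_space_copy_space: "prob_space M \<Longrightarrow> prob_space (copy_space M k)"
  unfolding copy_space_def by (rule prob_space_PiM)

lemma measurable_copy [measurable (raw)]: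
  "l < k \<Longrightarrow> X \<in> M \<rightarrow>\<^sub>M N \<Longrightarrow> (\<lambda>w. X (w l)) \<in> copy_space M k \<rightarrow>\<^sub>M N"
  unfolding copy_space_def
  by (rule measurable_compose[OF measurable_component_singleton]) auto

lemma tendsto_in_prob_vdot_copy_same:
  assumes M: "prob_space M" and X [measurable]: "\<And>n. X n \<in> M \<rightarrow>\<^sub>M Rn (d n)"
    and lim: "tendsto_in_prob M (\<lambda>n \<omega>. (vnorm (d n) (X n \<omega>))\<^sup>2) c" and l: "l < k"
  shows "tendsto_in_prob (copy_space M k) (\<lambda>n w. vdot (d n) (X n (w l)) (X n (w l))) c"
proof -
  have distr: "distr (copy_space M k) M (\<lambda>w. w l) = M"
    using l unfolding copy_space_def by (intro distr_PiM_component) (auto simp: M)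
  have [measurable]: "(\<lambda>w. w l) \<in> copy_space M k \<rightarrow>\<^sub>M M"
    using measurable_copy[OF l measurable_ident] by (simp add: id_def)
  have "measure (copy_space M k) {w \<in> space (copy_space M k). e < \<bar>vdot (d n) (X n (w l)) (X n (w l)) - c\<bar>}
      = measure M {\<omega> \<in> space M. e < \<bar>vdot (d n) (X n \<omega>) (X n \<omega>) - c\<bar>}" for e n
  proof -
    have "measure (distr (copy_space M k) M (\<lambda>w. w l)) {\<omega> \<in> space M. e < \<bar>vdot (d n) (X n \<omega>) (X n \<omega>) - c\<bar>}
        = measure (copy_space M k) ((\<lambda>w. w l) -` {\<omega> \<in> space M. e < \<bar>vdot (d n) (X n \<omega>) (X n \<omega>) - c\<bar>}
            \<inter> space (copy_space M k))"
      by (rule measure_distr) measurable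
    also have "(\<lambda>w. w l) -` {\<omega> \<in> space M. e < \<bar>vdot (d n) (X n \<omega>) (X n \<omega>) - c\<bar>} \<inter> space (copy_space M k)
        = {w \<in> space (copy_space M k). e < \<bar>vdot (d n) (X n (w l)) (X n (w l)) - c\<bar>}"
      using l by (auto simp: copy_space_def space_PiM)
    finally show ?thesis by (simp add: distr)
  qed
  then show ?thesis using lim by (simp add: tendsto_in_prob_def vnorm_power2)
qed

text \<open>The hypothesis speaks of two copies on the square of \<open>M\<close>, the Gram matrix
  of copies on a higher power. Distinct coordinates \<open>l\<close> and \<open>r\<close> of that
  power, reindexed along the injection \<open>p\<close>, have the law of the square.\<close>

lemma tendsto_in_prob_vdot_copy_distinct:
  assumes M: "prob_space M" and X [measurable]: "\<And>n. X n \<in> M \<rightarrow>\<^sub>M Rn (d n)"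
    and lim: "tendsto_in_prob (copy_space M 2)
      (\<lambda>n w. vdot (d n) (copy (X n) 0 w) (copy (X n) 1 w)) c"
    and l: "l < k" "r < k" "l \<noteq> r"
  shows "tendsto_in_prob (copy_space M k) (\<lambda>n w. vdot (d n) (X n (w l)) (X n (w r))) c"
proof -
  define p where "p i = (if i = 0 then l else r)" for i :: nat
  define T where "T w = (\<lambda>i\<in>{..<2::nat}. w (p i))" for w :: "nat \<Rightarrow> 'a"
  have p: "inj_on p {..<2}" "p \<in> {..<2} \<rightarrow> {..<k}"
    using l by (auto simp: p_def inj_on_def)
  have distr: "distr (copy_space M k) (copy_space M 2) T = copy_space M 2"
    using distr_PiM_reindex[OF _ p, of "\<lambda>_. M"] M by (simp add: copy_space_def T_def[abs_def])
  have T [measurable]: "T \<in> copy_space M k \<rightarrow>\<^sub>M copy_space M 2"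
    unfolding T_def[abs_def] copy_space_def using p(2)
    by (intro measurable_restrict measurable_component_singleton) auto
  have T01: "T w 0 = w l" "T w 1 = w r" for w
    by (auto simp: T_def p_def)
  have "measure (copy_space M k) {w \<in> space (copy_space M k). e < \<bar>vdot (d n) (X n (w l)) (X n (w r)) - c\<bar>}
      = measure (copy_space M 2) {v \<in> space (copy_space M 2). e < \<bar>vdot (d n) (X n (v 0)) (X n (v 1)) - c\<bar>}"
    (is "_ = measure _ ?A") for e n
  proof -
    have "measure (distr (copy_space M k) (copy_space M 2) T) ?A
        = measure (copy_space M k) (T -` ?A \<inter> space (copy_space M k))"
      by (rule measure_distr) measurable
    also have "T -` ?A \<inter> space (copy_space M k)
        = {w \<in> space (copy_space M k). e < \<bar>vdot (d n) (X n (w l)) (X n (w r)) - c\<bar>}"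
      using measurable_space[OF T] by (auto simp: T01 T01(2)[unfolded One_nat_def])
    finally show ?thesis by (simp add: distr)
  qed
  then show ?thesis using lim by (simp add: tendsto_in_prob_def copy_def)
qed

text \<open>Scaling represents all centred normal laws by one sample, so that a random scale fits
  the encoding of random laws. It holds for every real \<open>s\<close>: zero gives the point mass,
  and the sign disappears by symmetry.\<close>

lemma normal_law_square:
  "normal_law 0 (s\<^sup>2) = distr std_normal_distribution borel (\<lambda>z. s * z)"
proof (cases "s = 0")
  case True
  interpret prob_space std_normal_distribution by (rule prob_space_normal_density) simp
  show ?thesis using True by (simp add: normal_law_def)
next
  case False
  interpret prob_space std_normal_distribution by (rule prob_space_normal_density) simp
  have "distributed std_normal_distribution lborel (\<lambda>x. x) std_normal_density"
    by (auto simp: distributed_def distr_id2)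
  from normal_density_affine[OF this, of s 0] False
  have "distr std_normal_distribution lborel (\<lambda>z. s * z) = density lborel (normal_density 0 \<bar>s\<bar>)"
    by (auto simp: distributed_def)
  moreover have "distr std_normal_distribution lborel (\<lambda>z. s * z) = distr std_normal_distribution borel (\<lambda>z. s * z)"
    by (rule distr_cong) auto
  ultimately show ?thesis using False by (simp add: normal_law_def)
qed

text \<open>\<open>Z\<close> and \<open>X\<close> are read at separate points of \<open>M\<close>,
  which makes them independent by construction. That this gives the actual conditional law is shown
  in \<open>cond_cdf_vdot_indep\<close>.\<close>

lemma random_law_vdot:
  assumes "prob_space M" and [measurable]: "Z \<in> M \<rightarrow>\<^sub>M Rn d" "X \<in> M \<rightarrow>\<^sub>M Rn d"
  shows "random_law M M (\<lambda>\<omega> \<omega>'. vdot d (Z \<omega>) (X \<omega>'))"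
  using assms(1) by (simp add: random_law_def random_law_axioms_def split_beta')

text \<open>For fixed \<open>Z\<close>, the factors are integrated over independent copies of
  \<open>X\<close>. The exponents collect into one inner product of \<open>Z\<close> with a
  combination of the copies, so integrating over \<open>Z\<close> first produces its characteristic
  function there.\<close>

lemma char_moment_vdot:
  assumes M: "prob_space M" and [measurable]: "Z \<in> M \<rightarrow>\<^sub>M Rn d" "X \<in> M \<rightarrow>\<^sub>M Rn d"
  shows "(\<integral>\<omega>. (\<Prod>l<j. char (random_law.law M (\<lambda>\<omega> \<omega>'. vdot d (Z \<omega>) (X \<omega>')) \<omega>) (t l)) \<partial>M)
    = (\<integral>w. char_fun M d Z (\<lambda>i\<in>{..<d}. \<Sum>l<j. t l * X (w l) i) \<partial>copy_space M j)"
proof -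
  interpret random_law M M "\<lambda>\<omega> \<omega>'. vdot d (Z \<omega>) (X \<omega>')"
    by (rule random_law_vdot) fact+
  interpret C: product_sigma_finite "\<lambda>_. M"
    by (simp add: product_sigma_finite_def P.sigma_finite_measure_axioms)
  interpret CP: prob_space "copy_space M j" by (rule prob_space_copy_space[OF M])
  interpret CM: pair_prob_space "copy_space M j" M ..
  let ?F = "\<lambda>w \<omega>. iexp (vdot d (\<lambda>i\<in>{..<d}. \<Sum>l<j. t l * X (w l) i) (Z \<omega>))"
  have F: "?F w \<omega> = (\<Prod>l<j. iexp (t l * vdot d (Z \<omega>) (X (w l))))" for w \<omega>
    unfolding vdot_sum_left by (simp add: vdot_commute sum_distrib_left exp_sum)
  have "(\<Prod>l<j. char (law \<omega>) (t l)) = (\<integral>w. ?F w \<omega> \<partial>copy_space M j)" if \<omega>: "\<omega> \<in> space M" for \<omega>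
  proof -
    have int: "integrable M (\<lambda>\<omega>'. iexp (t l * vdot d (Z \<omega>) (X \<omega>')))" for l
      using \<omega> by (intro P.integrable_const_bound[where B=1]) auto
    have "(\<Prod>l<j. char (law \<omega>) (t l)) = (\<Prod>l<j. \<integral>\<omega>'. iexp (t l * vdot d (Z \<omega>) (X \<omega>')) \<partial>M)"
      unfolding char_def using \<omega> by (intro prod.cong refl integral_law) auto
    also have "\<dots> = (\<integral>w. (\<Prod>l<j. iexp (t l * vdot d (Z \<omega>) (X (w l)))) \<partial>copy_space M j)"
      unfolding copy_space_def using int by (subst C.product_integral_prod) auto
    finally show ?thesis by (simp only: F)
  qed
  then have "(\<integral>\<omega>. (\<Prod>l<j. char (law \<omega>) (t l)) \<partial>M) = (\<integral>\<omega>. (\<integral>w. ?F w \<omega> \<partial>copy_space M j) \<partial>M)"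
    by (intro Bochner_Integration.integral_cong) auto
  also have "\<dots> = (\<integral>w. (\<integral>\<omega>. ?F w \<omega> \<partial>M) \<partial>copy_space M j)"
  proof (rule CM.Fubini_integral, rule CM.integrable_const_bound[where B=1])
    have [measurable]: "(\<lambda>z. X (fst z l)) \<in> copy_space M j \<Otimes>\<^sub>M M \<rightarrow>\<^sub>M Rn d" if "l < j" for l
      using that by (intro measurable_compose[OF measurable_fst measurable_copy]) auto
    show "(\<lambda>(w, \<omega>). ?F w \<omega>) \<in> borel_measurable (copy_space M j \<Otimes>\<^sub>M M)"
      unfolding F split_beta' by measurable
  qed auto
  finally show ?thesis by (simp add: char_fun_def)
qed

lemma tendsto_in_prob_vnorm_sum:
  assumes M: "prob_space M" and X [measurable]: "\<And>n. X n \<in> M \<rightarrow>\<^sub>M Rn (d n)"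
    and norm: "tendsto_in_prob M (\<lambda>n \<omega>. (vnorm (d n) (X n \<omega>))\<^sup>2) c"
    and orth: "tendsto_in_prob (copy_space M 2)
      (\<lambda>n w. vdot (d n) (copy (X n) 0 w) (copy (X n) 1 w)) 0"
  shows "tendsto_in_prob (copy_space M j)
    (\<lambda>n w. (vnorm (d n) (\<lambda>i\<in>{..<d n}. \<Sum>l<j. t l * X n (w l) i))\<^sup>2) (c * (\<Sum>l<j. (t l)\<^sup>2))"
proof -
  have "tendsto_in_prob (copy_space M j) (\<lambda>n w. t l * t r * vdot (d n) (X n (w l)) (X n (w r)))
      (t l * t r * (if l = r then c else 0))" if "l < j" "r < j" for l r
    using that tendsto_in_prob_vdot_copy_same[OF M X norm that(1)]
      tendsto_in_prob_vdot_copy_distinct[OF M X orth that]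
    by (intro tendsto_in_prob_cmult) auto
  then have "tendsto_in_prob (copy_space M j)
      (\<lambda>n w. \<Sum>l<j. \<Sum>r<j. t l * t r * vdot (d n) (X n (w l)) (X n (w r)))
      (\<Sum>l<j. \<Sum>r<j. t l * t r * (if l = r then c else 0))"
    by (intro tendsto_in_prob_sum prob_space_copy_space M finite_lessThan borel_measurable_sum
        borel_measurable_times measurable_const measurable_vdot measurable_copy X) auto
  moreover have "(\<Sum>l<j. \<Sum>r<j. t l * t r * (if l = r then c else 0)) = c * (\<Sum>l<j. (t l)\<^sup>2)"
    by (simp add: if_distrib[of "\<lambda>x. _ * x"] sum.delta sum_distrib_left power2_eq_square mult_ac cong: if_cong)
  ultimately show ?thesis
    unfolding vnorm_sum_power2 by simp
qed

lemma char_moment_vdot_tendsto: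
  assumes M: "prob_space M" and X [measurable]: "\<And>n. X n \<in> M \<rightarrow>\<^sub>M Rn (d n)"
    and Z [measurable]: "\<And>n. Z n \<in> M \<rightarrow>\<^sub>M Rn (d n)"
    and norm: "tendsto_in_prob M (\<lambda>n \<omega>. (vnorm (d n) (X n \<omega>))\<^sup>2) c"
    and orth: "tendsto_in_prob (copy_space M 2)
      (\<lambda>n w. vdot (d n) (copy (X n) 0 w) (copy (X n) 1 w)) 0"
    and Z_char: "\<And>n u. u \<in> space (Rn (d n)) \<Longrightarrow>
      char_fun M (d n) (Z n) u = complex_of_real (g ((vnorm (d n) u)\<^sup>2))"
    and cont: "\<And>x. isCont g x" and B: "\<And>x. \<bar>g x\<bar> \<le> B"
  shows "(\<lambda>n. \<integral>\<omega>. (\<Prod>l<(j::nat). char (random_law.law M (\<lambda>\<omega> \<omega>'. vdot (d n) (Z n \<omega>) (X n \<omega>')) \<omega>) (t l)) \<partial>M)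
    \<longlonglongrightarrow> complex_of_real (g (c * (\<Sum>l<j. (t l)\<^sup>2)))"
proof -
  let ?U = "\<lambda>n w. (vnorm (d n) (\<lambda>i\<in>{..<d n}. \<Sum>l<j. t l * X n (w l) i))\<^sup>2"
  have meas: "?U n \<in> borel_measurable (copy_space M j)" for n
    unfolding vnorm_sum_power2
    by (intro borel_measurable_sum borel_measurable_times measurable_const measurable_vdot measurable_copy X) auto
  have "(\<lambda>i\<in>{..<d n}. \<Sum>l<j. t l * X n (w l) i) \<in> space (Rn (d n))" for n w
    by (simp add: Rn_def space_PiM)
  then have "(\<integral>\<omega>. (\<Prod>l<j. char (random_law.law M (\<lambda>\<omega> \<omega>'. vdot (d n) (Z n \<omega>) (X n \<omega>')) \<omega>) (t l)) \<partial>M)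
      = complex_of_real (\<integral>w. g (?U n w) \<partial>copy_space M j)" for n
    by (simp add: char_moment_vdot[OF M Z X] Z_char)
  moreover have "(\<lambda>n. \<integral>w. g (?U n w) \<partial>copy_space M j) \<longlonglongrightarrow> g (c * (\<Sum>l<j. (t l)\<^sup>2))"
    by (rule tendsto_in_prob_imp_integral_tendsto[OF prob_space_copy_space[OF M] meas
          tendsto_in_prob_vnorm_sum[OF M X norm orth] cont B])
  ultimately show ?thesis by (simp add: tendsto_of_real)
qed

subsection \<open>The normal variance mixture\<close>

lemma random_law_normal_scale:
  assumes "prob_space N" and [measurable]: "S \<in> borel_measurable N"
  shows "random_law N std_normal_distribution (\<lambda>\<omega> z. S \<omega> * z)"
  using assms(1) prob_space_normal_density[of 1 0]
  by (simp add: random_law_def random_law_axioms_def split_beta')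

lemma law_normal_scale:
  assumes "prob_space N" "S \<in> borel_measurable N"
  shows "random_law.law std_normal_distribution (\<lambda>\<omega> z. S \<omega> * z) \<omega> = normal_law 0 ((S \<omega>)\<^sup>2)"
  by (simp add: random_law.law_def[OF random_law_normal_scale[OF assms]] normal_law_square)

lemma char_normal_law: "char (normal_law 0 (s\<^sup>2)) t = complex_of_real (exp (- (s * t)\<^sup>2 / 2))"
proof -
  have "char (normal_law 0 (s\<^sup>2)) t = char std_normal_distribution (s * t)"
    unfolding normal_law_square char_def by (subst integral_distr) (auto simp: mult_ac)
  then show ?thesis by (simp add: char_std_normal_distribution)
qed

text \<open>Where \<open>S\<close> does not vanish, the section of the event is the single point
  \<open>y / S \<omega>\<close>, which the Gaussian does not charge; Fubini does the rest.\<close>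

lemma mean_law_normal_scale_atomless:
  assumes N: "prob_space N" and S [measurable]: "S \<in> borel_measurable N" and S0: "AE \<omega> in N. S \<omega> \<noteq> 0"
  shows "measure (random_law.mean_law N std_normal_distribution (\<lambda>\<omega> z. S \<omega> * z)) {y} = 0"
proof -
  interpret random_law N std_normal_distribution "\<lambda>\<omega> z. S \<omega> * z"
    by (rule random_law_normal_scale[OF N S])
  let ?A = "{z \<in> space (N \<Otimes>\<^sub>M std_normal_distribution). S (fst z) * snd z = y}"
  have "emeasure std_normal_distribution (Pair \<omega> -` ?A) = 0" if "S \<omega> \<noteq> 0" "\<omega> \<in> space N" for \<omega>
  proof -
    have "Pair \<omega> -` ?A = {y / S \<omega>}"
      using that by (auto simp: space_pair_measure field_simps)
    moreover have "AE z in std_normal_distribution. z \<notin> {y / S \<omega>}"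
      by (subst AE_density) (auto intro: eventually_mono[OF AE_lborel_singleton])
    then have "emeasure std_normal_distribution {y / S \<omega>} = 0"
      by (subst AE_iff_measurable[where P="\<lambda>z. z \<notin> {y / S \<omega>}", symmetric]) auto
    ultimately show ?thesis by simp
  qed
  then have "AE \<omega> in N. emeasure std_normal_distribution (Pair \<omega> -` ?A) = 0"
    using S0 by auto
  moreover have A: "?A \<in> sets (N \<Otimes>\<^sub>M std_normal_distribution)"
    by measurable
  ultimately have "emeasure (N \<Otimes>\<^sub>M std_normal_distribution) ?A = 0"
    by (subst Q.emeasure_pair_measure_alt[OF A]) (simp add: nn_integral_0_iff_AE Q.measurable_emeasure_Pair[OF A])
  moreover have "case_prod (\<lambda>\<omega> z. S \<omega> * z) -` {y} \<inter> space (N \<Otimes>\<^sub>M std_normal_distribution) = ?A"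
    by auto
  ultimately show ?thesis
    unfolding mean_law_def by (subst measure_distr) (auto simp: measure_def)
qed

subsection \<open>The conditional distribution function\<close>

text \<open>By independence the joint law is a product, so conditioning on \<open>Z\<close> amounts
  to freezing its value. It suffices to compare integrals over the preimages of Borel sets under
  \<open>Z\<close>.\<close>

lemma cond_cdf_vdot_indep:
  assumes M: "prob_space M"
    and indep: "prob_space.indep_var M (Rn d) Z (Rn d) X"
    and Y: "\<And>\<omega>. \<omega> \<in> space M \<Longrightarrow> Y \<omega> = vdot d (Z \<omega>) (X \<omega>)"
  shows "AE \<omega> in M. cond_cdf M (Rn d) Z Y y \<omega>
    = cdf (random_law.law M (\<lambda>\<omega> \<omega>'. vdot d (Z \<omega>) (X \<omega>')) \<omega>) y"
proof -
  interpret prob_space M by (rule M)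
  have Z [measurable]: "Z \<in> M \<rightarrow>\<^sub>M Rn d" and X [measurable]: "X \<in> M \<rightarrow>\<^sub>M Rn d"
    using indep_var_rv1[OF indep] indep_var_rv2[OF indep] by auto
  interpret L: random_law M M "\<lambda>\<omega> \<omega>'. vdot d (Z \<omega>) (X \<omega>')"
    by (rule random_law_vdot[OF M Z X])
  interpret DZ: prob_space "distr M (Rn d) Z" by (rule prob_space_distr) simp
  interpret DX: prob_space "distr M (Rn d) X" by (rule prob_space_distr) simp
  interpret D: pair_prob_space "distr M (Rn d) Z" "distr M (Rn d) X" ..
  have joint: "distr M (Rn d \<Otimes>\<^sub>M Rn d) (\<lambda>\<omega>. (Z \<omega>, X \<omega>)) = distr M (Rn d) Z \<Otimes>\<^sub>M distr M (Rn d) X"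
    using indep unfolding indep_var_distribution_eq by simp
  let ?F = "vimage_algebra (space M) Z (Rn d)"
  have sub: "subalgebra M ?F" by (rule subalgebra_vimage_algebra) simp
  interpret S: finite_measure_subalgebra M ?F
    by (simp add: finite_measure_subalgebra_def finite_measure_subalgebra_axioms_def sub finite_measure_axioms)
  define K :: "(nat \<Rightarrow> real) \<Rightarrow> real" where "K u = (\<integral>\<omega>'. indicator {..y} (vdot d u (X \<omega>')) \<partial>M)" for u
  have K_meas [measurable]: "K \<in> borel_measurable (Rn d)"
    unfolding K_def by measurable
  have K_cdf: "cdf (L.law \<omega>) y = K (Z \<omega>)" if "\<omega> \<in> space M" for \<omega>
    unfolding K_def L.cdf_law_eq[OF that] by (rule L.integral_law[OF _ that]) simp
  let ?Y = "{\<omega> \<in> space M. Y \<omega> \<le> y}"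
  have Y_eq: "?Y = {\<omega> \<in> space M. vdot d (Z \<omega>) (X \<omega>) \<le> y}" using Y by auto
  have [measurable]: "?Y \<in> sets M" unfolding Y_eq by measurable
  have "AE \<omega> in M. real_cond_exp M ?F (indicator ?Y) \<omega> = K (Z \<omega>)"
  proof (rule S.real_cond_exp_charact)
    fix A assume "A \<in> sets ?F"
    then obtain B where B [measurable]: "B \<in> sets (Rn d)" and A: "A = Z -` B \<inter> space M"
      using measurable_space[OF Z] by (auto simp: sets_vimage_algebra2)
    let ?h = "\<lambda>(u, x). indicator B u * indicator {..y} (vdot d u x) :: real"
    have h [measurable]: "?h \<in> borel_measurable (Rn d \<Otimes>\<^sub>M Rn d)" by measurable
    have "(\<integral>\<omega>\<in>A. indicator ?Y \<omega> \<partial>M) = (\<integral>\<omega>. ?h (Z \<omega>, X \<omega>) \<partial>M)"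
      unfolding set_lebesgue_integral_def A Y_eq
      by (intro Bochner_Integration.integral_cong) (auto split: split_indicator)
    also have "\<dots> = (\<integral>p. ?h p \<partial>distr M (Rn d \<Otimes>\<^sub>M Rn d) (\<lambda>\<omega>. (Z \<omega>, X \<omega>)))"
      by (rule integral_distr[symmetric]) (auto intro!: h)
    also have "\<dots> = (\<integral>p. ?h p \<partial>(distr M (Rn d) Z \<Otimes>\<^sub>M distr M (Rn d) X))"
      by (simp only: joint)
    also have "\<dots> = (\<integral>u. \<integral>x. ?h (u, x) \<partial>distr M (Rn d) X \<partial>distr M (Rn d) Z)"
      by (rule D.integral_fst'[symmetric], rule D.integrable_const_bound[where B=1])
         (auto split: split_indicator)
    also have "\<dots> = (\<integral>u. indicator B u * K u \<partial>distr M (Rn d) Z)"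
      by (intro Bochner_Integration.integral_cong refl) (simp add: K_def integral_distr)
    also have "\<dots> = (\<integral>\<omega>. indicator B (Z \<omega>) * K (Z \<omega>) \<partial>M)"
      by (rule integral_distr) measurable
    also have "\<dots> = (\<integral>\<omega>\<in>A. K (Z \<omega>) \<partial>M)"
      unfolding set_lebesgue_integral_def A
      by (intro Bochner_Integration.integral_cong) (auto split: split_indicator)
    finally show "(\<integral>\<omega>\<in>A. indicator ?Y \<omega> \<partial>M) = (\<integral>\<omega>\<in>A. K (Z \<omega>) \<partial>M)" .
  next
    show "integrable M (indicator ?Y :: 'a \<Rightarrow> real)"
      by (rule integrable_const_bound[where B=1]) (auto simp: indicator_le_1)
    have "integrable M (\<lambda>\<omega>. cdf (L.law \<omega>) y ^ 1)" by (rule L.integrable_cdf_law_power)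
    then show "integrable M (\<lambda>\<omega>. K (Z \<omega>))"
      by (subst (asm) Bochner_Integration.integrable_cong[OF refl, where g="\<lambda>\<omega>. K (Z \<omega>)"]) (auto simp: K_cdf)
    show "(\<lambda>\<omega>. K (Z \<omega>)) \<in> borel_measurable ?F"
      using measurable_space[OF Z] by (intro measurable_compose[OF measurable_vimage_algebra1 K_meas]) auto
  qed
  then show ?thesis
    unfolding cond_cdf_def by (auto simp: K_cdf elim!: AE_mp intro!: AE_I2)
qed

text \<open>The exceptional null set may depend on \<open>y\<close>. This is harmless because
  \<open>y\<close> is fixed under the integral and the supremum is taken afterwards.\<close>

lemma integral_cond_cdf_vdot_indep:
  assumes M: "prob_space M"
    and indep: "prob_space.indep_var M (Rn d) Z (Rn d) X"
    and Y: "\<And>\<omega>. \<omega> \<in> space M \<Longrightarrow> Y \<omega> = vdot d (Z \<omega>) (X \<omega>)"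
  shows "(\<integral>\<omega>. cond_cdf M (Rn d) Z Y y \<omega> ^ j \<partial>M)
    = random_law.cdf_moment M M (\<lambda>\<omega> \<omega>'. vdot d (Z \<omega>) (X \<omega>')) j y"
proof -
  interpret prob_space M by (rule M)
  have Z: "Z \<in> M \<rightarrow>\<^sub>M Rn d" and X: "X \<in> M \<rightarrow>\<^sub>M Rn d"
    using indep_var_rv1[OF indep] indep_var_rv2[OF indep] by auto
  interpret L: random_law M M "\<lambda>\<omega> \<omega>'. vdot d (Z \<omega>) (X \<omega>')"
    by (rule random_law_vdot[OF M Z X])
  show ?thesis
    unfolding L.cdf_moment_def
  proof (rule integral_cong_AE)
    show "(\<lambda>\<omega>. cond_cdf M (Rn d) Z Y y \<omega> ^ j) \<in> borel_measurable M"
      unfolding cond_cdf_def by measurable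
    show "(\<lambda>\<omega>. cdf (L.law \<omega>) y ^ j) \<in> borel_measurable M"
      using L.integrable_cdf_law_power by (rule borel_measurable_integrable)
    show "AE \<omega> in M. cond_cdf M (Rn d) Z Y y \<omega> ^ j = cdf (L.law \<omega>) y ^ j"
      using cond_cdf_vdot_indep[OF M indep Y, where y=y] by auto
  qed
qed

subsection \<open>The mixing distribution\<close>

text \<open>\<open>G\<close> occurs as the integrator in the mixture formula for
  \<open>\<psi>\<close> and as the distribution function of \<open>V\<close>; identifying the two
  measures turns every integral into an expectation over \<open>N\<close>.\<close>

lemma interval_measure_eq_distr:
  assumes N: "prob_space N" and V: "V \<in> borel_measurable N"
    and G: "distribution_function_nonneg G" and V_G: "cdf (distr N borel V) = G"
  shows "interval_measure G = distr N borel V"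
proof -
  interpret N: prob_space N by (rule N)
  interpret D: real_distribution "distr N borel V" by (rule N.real_distribution_distr[OF V])
  have mono: "x \<le> y \<Longrightarrow> G x \<le> G y" for x y
    using G by (auto simp: distribution_function_nonneg_def mono_def)
  have cont: "continuous (at_right a) G" for a
    using G by (auto simp: distribution_function_nonneg_def)
  have bot: "(G \<longlongrightarrow> 0) at_bot" using D.cdf_lim_at_bot by (simp add: V_G)
  have top: "(G \<longlongrightarrow> 1) at_top" using D.cdf_lim_at_top_prob by (simp add: V_G)
  show ?thesis
  proof (rule cdf_unique)
    show "real_distribution (interval_measure G)"
      using mono cont bot top by (rule real_distribution_interval_measure)
    show "cdf (interval_measure G) = cdf (distr N borel V)"
      unfolding V_G using mono cont bot by (rule cdf_interval_measure)
  qed (rule D.real_distribution_axioms)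
qed

text \<open>The mass of the open negative half-line is the left limit of \<open>G\<close> at 0. An
  atom at 0 itself is still possible here.\<close>

lemma AE_nonneg_distribution_function:
  assumes N: "prob_space N" and V [measurable]: "V \<in> borel_measurable N"
    and G: "distribution_function_nonneg G" and V_G: "cdf (distr N borel V) = G"
  shows "AE \<omega> in N. 0 \<le> V \<omega>"
proof -
  interpret N: prob_space N by (rule N)
  interpret D: real_distribution "distr N borel V" by (rule N.real_distribution_distr[OF V])
  have "(G \<longlongrightarrow> measure (distr N borel V) {..<0}) (at_left 0)"
    using D.cdf_at_left[of 0] by (simp add: V_G)
  moreover have "(G \<longlongrightarrow> 0) (at_left 0)"
  proof (rule tendsto_eventually)
    show "\<forall>\<^sub>F v in at_left 0. G v = 0"
      using G by (auto simp: distribution_function_nonneg_def eventually_at_left_field intro: exI[of _ "-1"])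
  qed
  ultimately have "measure (distr N borel V) {..<0} = 0"
    by (rule tendsto_unique[rotated]) simp
  then have "{..<0} \<in> null_sets (distr N borel V)"
    by (auto simp: D.emeasure_eq_measure)
  then have "AE v in distr N borel V. v \<notin> {..<0}"
    by (rule AE_not_in)
  then show ?thesis by (simp add: AE_distr_iff not_less)
qed

text \<open>The absolute value extends the Laplace transform of the squared variable to an even
  function on the line, so that continuity and boundedness hold without restriction to nonnegative
  arguments.\<close>

lemma isCont_Laplace_square:
  fixes V :: "'a \<Rightarrow> real"
  assumes N: "prob_space N" and V [measurable]: "V \<in> borel_measurable N"
  shows "isCont (\<lambda>x. \<integral>\<omega>. exp (- \<bar>x\<bar> * (V \<omega>)\<^sup>2 / 2) \<partial>N) (x :: real)"
  unfolding continuous_at_sequentially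
proof safe
  interpret prob_space N by (rule N)
  fix s assume s: "s \<longlonglongrightarrow> x"
  show "((\<lambda>x. \<integral>\<omega>. exp (- \<bar>x\<bar> * (V \<omega>)\<^sup>2 / 2) \<partial>N) \<circ> s) \<longlonglongrightarrow> (\<integral>\<omega>. exp (- \<bar>x\<bar> * (V \<omega>)\<^sup>2 / 2) \<partial>N)"
    unfolding comp_def
    by (rule integral_dominated_convergence[where w="\<lambda>_. 1"]) (auto intro!: tendsto_intros s)
qed

lemma abs_Laplace_square_le_1:
  fixes V :: "'a \<Rightarrow> real"
  assumes N: "prob_space N" and V [measurable]: "V \<in> borel_measurable N"
  shows "\<bar>\<integral>\<omega>. exp (- \<bar>x\<bar> * (V \<omega>)\<^sup>2 / 2) \<partial>N\<bar> \<le> (1 :: real)"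
proof -
  interpret prob_space N by (rule N)
  have "\<bar>\<integral>\<omega>. exp (- \<bar>x\<bar> * (V \<omega>)\<^sup>2 / 2) \<partial>N\<bar> = (\<integral>\<omega>. exp (- \<bar>x\<bar> * (V \<omega>)\<^sup>2 / 2) \<partial>N)"
    by (intro abs_of_nonneg Bochner_Integration.integral_nonneg) simp
  also have "\<dots> \<le> 1"
    by (intro integral_le_const integrable_const_bound[where B=1]) auto
  finally show ?thesis .
qed

section \<open>Uniform convergence of the moments of the conditional distribution function\<close>

theorem theorem5p1:
  fixes M :: "'a measure" and N :: "'b measure"
    and d :: "nat \<Rightarrow> nat" and k :: nat and \<sigma> :: real
    and X \<Xi> :: "nat \<Rightarrow> 'a \<Rightarrow> nat \<Rightarrow> real" and Y :: "nat \<Rightarrow> 'a \<Rightarrow> real"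
    and \<psi> G :: "real \<Rightarrow> real" and V :: "'b \<Rightarrow> real"
  assumes M: "prob_space M"
    and k: "k \<ge> 1" and \<sigma>: "\<sigma>\<^sup>2 > 0"
    and d_pos: "\<And>n. n \<ge> 1 \<Longrightarrow> d n \<ge> 1"
    and d_mono: "mono_on {1..} d"
    and d_lim: "filterlim d at_top sequentially"
    and X_density: "\<And>n. n \<ge> 1 \<Longrightarrow> has_continuous_density M (d n) (X n)"
    and cond1: "tendsto_in_prob M (\<lambda>n \<omega>. (vnorm (d n) (X n \<omega>))\<^sup>2) (\<sigma>\<^sup>2)"
    and cond2: "tendsto_in_prob (copy_space M 2)
                  (\<lambda>n w. vdot (d n) (copy (X n) 0 w) (copy (X n) 1 w)) 0"
    and cond3: "\<exists>n0\<ge>1. (\<integral>\<^sup>+ w. inverse (ennreal (sqrt (Determinant.det (gram (d n0) k (X n0) w))))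
                          \<partial>copy_space M k) < \<infinity>"
    and cond4: "\<And>n. n \<ge> 1 \<Longrightarrow>
                  AE \<theta> in surface_measure (d n).
                    (\<integral>\<^sup>+ t. ennreal (cmod (char_fun M (d n) (X n) (vscale (d n) t \<theta>))) \<partial>lborel) < \<infinity>"
    and \<Xi>_density: "\<And>n. n \<ge> 1 \<Longrightarrow> has_continuous_density M (d n) (\<Xi> n)"
    and indep: "prob_space.indep_var M
                  (Pi\<^sub>M {1..} (\<lambda>n. Rn (d n))) (\<lambda>\<omega>. \<lambda>n\<in>{1..}. \<Xi> n \<omega>)
                  (Pi\<^sub>M {1..} (\<lambda>n. Rn (d n))) (\<lambda>\<omega>. \<lambda>n\<in>{1..}. X n \<omega>)"
    and \<Xi>_spherical: "\<And>n. n \<ge> 1 \<Longrightarrow> spherically_symmetric M (d n) (\<Xi> n)"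
    and \<Xi>_char: "\<And>n u. n \<ge> 1 \<Longrightarrow> u \<in> space (Rn (d n)) \<Longrightarrow>
                   char_fun M (d n) (\<Xi> n) u = complex_of_real (\<psi> ((vnorm (d n) u)\<^sup>2))"
    and G: "distribution_function_nonneg G"
    and \<psi>_G: "\<And>t. \<psi> (t\<^sup>2) = (LINT v:{0..}|interval_measure G. exp (- t\<^sup>2 * v\<^sup>2 / 2))"
    and G_moments: "\<And>n. n \<ge> 1 \<Longrightarrow>
                   (\<integral>\<^sup>+ v\<in>{0..}. inverse (ennreal v ^ d n) \<partial>interval_measure G) < \<infinity>"
    and N: "prob_space N" and V: "V \<in> borel_measurable N" and V_G: "cdf (distr N borel V) = G"
    and Y: "\<And>n \<omega>. n \<ge> 1 \<Longrightarrow> \<omega> \<in> space M \<Longrightarrow> Y n \<omega> = vdot (d n) (\<Xi> n \<omega>) (X n \<omega>)"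
  shows "\<forall>j\<in>{1..k}.
    (\<lambda>n. SUP y. \<bar>(LINT \<omega>|M. (cond_cdf M (Rn (d n)) (\<Xi> n) (Y n) y \<omega>) ^ j)
               - (LINT \<omega>|N. (cdf (normal_law 0 (\<sigma>\<^sup>2 * (V \<omega>)\<^sup>2)) y) ^ j)\<bar>) \<longlonglongrightarrow> 0"
proof
  fix j assume j: "j \<in> {1..k}"
  interpret M: prob_space M by (rule M)
  interpret N: prob_space N by (rule N)
  note [measurable] = V
  have \<Xi>_meas: "\<Xi> n \<in> M \<rightarrow>\<^sub>M Rn (d n)" and X_meas: "X n \<in> M \<rightarrow>\<^sub>M Rn (d n)" if "n \<ge> 1" for n
    using \<Xi>_density[OF that] X_density[OF that] by (auto simp: has_continuous_density_def distributed_def)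
  have indep_n: "M.indep_var (Rn (d n)) (\<Xi> n) (Rn (d n)) (X n)" if "n \<ge> 1" for n
    using M.indep_var_compose[OF indep, of "\<lambda>f. f n" "Rn (d n)" "\<lambda>f. f n" "Rn (d n)"] that
    by (simp add: comp_def)
  have D: "interval_measure G = distr N borel V"
    by (rule interval_measure_eq_distr[OF N V G V_G])
  have V_nonneg: "AE \<omega> in N. 0 \<le> V \<omega>"
    by (rule AE_nonneg_distribution_function[OF N V G V_G])
  \<comment> \<open>At \<open>v = 0\<close> this integrand is the inverse of 0 in
    \<open>ennreal\<close>, hence infinite, because \<open>d 1\<close> is positive. A finite
    integral leaves no mass there.\<close>
  have "AE v in distr N borel V. inverse (ennreal v ^ d 1) * indicator {0..} v \<noteq> \<infinity>"
    using G_moments[of 1] unfolding D by (intro nn_integral_noteq_infinite) auto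
  then have "AE \<omega> in N. inverse (ennreal (V \<omega>) ^ d 1) * indicator {0..} (V \<omega>) \<noteq> \<infinity>"
    by (simp add: AE_distr_iff)
  then have V_nonzero: "AE \<omega> in N. V \<omega> \<noteq> 0"
    by eventually_elim (use d_pos[of 1] in \<open>auto simp: zero_power\<close>)
  \<comment> \<open>The values of \<open>\<psi>\<close> at negative arguments are unconstrained;
    \<open>g\<close> agrees with it on the nonnegative ones and is continuous and bounded
    everywhere.\<close>
  define g where "g x = (\<integral>\<omega>. exp (- \<bar>x\<bar> * (V \<omega>)\<^sup>2 / 2) \<partial>N)" for x :: real
  have g_cont: "isCont g x" and g_le: "\<bar>g x\<bar> \<le> 1" for x
    unfolding g_def using isCont_Laplace_square[OF N V] abs_Laplace_square_le_1[OF N V] by auto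
  have \<psi>_g: "\<psi> x = g x" if "0 \<le> x" for x
  proof -
    have "\<psi> x = (\<integral>v. indicator {0..} v * exp (- x * v\<^sup>2 / 2) \<partial>distr N borel V)"
      using \<psi>_G[of "sqrt x"] that by (simp add: D set_lebesgue_integral_def)
    also have "\<dots> = (\<integral>\<omega>. indicator {0..} (V \<omega>) * exp (- x * (V \<omega>)\<^sup>2 / 2) \<partial>N)"
      by (rule integral_distr) measurable
    also have "\<dots> = g x"
      unfolding g_def using V_nonneg that by (intro integral_cong_AE) auto
    finally show ?thesis .
  qed
  define S where "S \<omega> = \<sigma> * V \<omega>" for \<omega>
  have S [measurable]: "S \<in> borel_measurable N"
    unfolding S_def by measurable
  have S_nonzero: "AE \<omega> in N. S \<omega> \<noteq> 0"
    using V_nonzero \<sigma> by (auto simp: S_def)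
  let ?f = "\<lambda>n \<omega> \<omega>'. vdot (d n) (\<Xi> n \<omega>) (X n \<omega>')" and ?limit = "\<lambda>\<omega> z. S \<omega> * z"
  interpret R0: random_law N std_normal_distribution ?limit
    by (rule random_law_normal_scale[OF N S])
  \<comment> \<open>The hypotheses start at index 1, so the sequence is shifted by one;
    \<open>LIMSEQ_imp_Suc\<close> undoes the shift at the end.\<close>
  have R: "random_law M M (?f (Suc n))" for n
    by (rule random_law_vdot[OF M \<Xi>_meas X_meas]) auto
  \<comment> \<open>A product of centred Gaussian characteristic functions depends on the
    frequencies only through their sum of squares, the value to which the Gram quadratic form
    converges up to the factor \<open>\<sigma>\<^sup>2\<close>.\<close>
  have char_limit: "(\<integral>\<omega>. (\<Prod>l<i. char (R0.law \<omega>) (t l)) \<partial>N)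
      = complex_of_real (g (\<sigma>\<^sup>2 * (\<Sum>l<i. (t l)\<^sup>2)))" for i :: nat and t
  proof -
    have "(\<Prod>l<i. char (R0.law \<omega>) (t l))
        = complex_of_real (exp (- \<bar>\<sigma>\<^sup>2 * (\<Sum>l<i. (t l)\<^sup>2)\<bar> * (V \<omega>)\<^sup>2 / 2))" for \<omega>
    proof -
      have "(\<Prod>l<i. exp (- (S \<omega> * t l)\<^sup>2 / 2)) = exp (- \<bar>\<sigma>\<^sup>2 * (\<Sum>l<i. (t l)\<^sup>2)\<bar> * (V \<omega>)\<^sup>2 / 2)"
        by (simp add: exp_sum[symmetric] abs_of_nonneg sum_nonneg S_def power_mult_distrib
            sum_distrib_left sum_distrib_right sum_divide_distrib sum_negf mult_ac)
      then show ?thesis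
        by (simp only: law_normal_scale[OF N S] char_normal_law of_real_prod[symmetric])
    qed
    then show ?thesis by (simp add: g_def)
  qed
  have conv: "(\<lambda>n. \<integral>\<omega>. (\<Prod>l<i. char (random_law.law M (?f (Suc n)) \<omega>) (t l)) \<partial>M)
      \<longlonglongrightarrow> (\<integral>\<omega>. (\<Prod>l<i. char (R0.law \<omega>) (t l)) \<partial>N)" for i :: nat and t
    unfolding char_limit
  proof (rule char_moment_vdot_tendsto[OF M X_meas \<Xi>_meas _ _ _ g_cont g_le])
    show "tendsto_in_prob M (\<lambda>n \<omega>. (vnorm (d (Suc n)) (X (Suc n) \<omega>))\<^sup>2) (\<sigma>\<^sup>2)"
      using cond1 unfolding tendsto_in_prob_def by (auto intro: LIMSEQ_Suc)
    show "tendsto_in_prob (copy_space M 2)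
        (\<lambda>n w. vdot (d (Suc n)) (copy (X (Suc n)) 0 w) (copy (X (Suc n)) 1 w)) 0"
      using cond2 unfolding tendsto_in_prob_def by (auto intro: LIMSEQ_Suc)
    show "char_fun M (d (Suc n)) (\<Xi> (Suc n)) u = complex_of_real (g ((vnorm (d (Suc n)) u)\<^sup>2))"
      if "u \<in> space (Rn (d (Suc n)))" for n u
      using \<Xi>_char[of "Suc n" u] that by (simp add: \<psi>_g)
  qed auto
  have unif: "uniform_limit UNIV (\<lambda>n. random_law.cdf_moment M M (?f (Suc n)) j) (R0.cdf_moment j) sequentially"
    using j by (intro uniform_limit_cdf_moment R R0.random_law_axioms conv
        mean_law_normal_scale_atomless[OF N S S_nonzero]) auto
  have moment: "random_law.cdf_moment M M (?f (Suc n)) j y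
      = (LINT \<omega>|M. (cond_cdf M (Rn (d (Suc n))) (\<Xi> (Suc n)) (Y (Suc n)) y \<omega>) ^ j)" for n y
    by (rule integral_cond_cdf_vdot_indep[OF M indep_n Y, symmetric]) auto
  have limit: "R0.cdf_moment j y = (LINT \<omega>|N. (cdf (normal_law 0 (\<sigma>\<^sup>2 * (V \<omega>)\<^sup>2)) y) ^ j)" for y
    by (simp only: R0.cdf_moment_def law_normal_scale[OF N S]) (simp add: S_def power_mult_distrib)
  show "(\<lambda>n. SUP y. \<bar>(LINT \<omega>|M. (cond_cdf M (Rn (d n)) (\<Xi> n) (Y n) y \<omega>) ^ j)
               - (LINT \<omega>|N. (cdf (normal_law 0 (\<sigma>\<^sup>2 * (V \<omega>)\<^sup>2)) y) ^ j)\<bar>) \<longlonglongrightarrow> 0"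
    by (rule LIMSEQ_imp_Suc) (rule uniform_limit_imp_SUP_tendsto_0[OF unif, unfolded moment limit])
qed

end
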